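(* Let $k\ge1$ be an integer and consider dimer RSA on $T_k$ and on $T_k^1$. For $t\in[0,1]$ and an arbitrary vertex $v$ of $T_k$ set $\alpha(t)=P[X_t^{T_k}(v)=0]$ and $\beta(t)=P[X_t^{T_k^1}(v_0)=0]$; for integer $m\ge1$ let $\mathrm{Cov}(m,t,T_k):=\mathrm{Cov}(X_t^{T_k}(v),X_t^{T_k}(w))$ for vertices $v,w$ of $T_k$ at graph distance $m$. Then for $k\ge2$, $$\beta(t)=(1+(k-1)t)^{-1/(k-1)},\qquad\alpha(t)=(1+(k-1)t)^{-(k+1)/(k-1)},$$ $$\mathrm{Cov}(m,t,T_k)=\beta(t)^{2k}\left(\frac{k(2\log\beta(t))^{m-1}}{(m-1)!\,(k-1)}-\sum_{j=m-1}^\infty\left(\frac{(2\log\beta(t))^j}{j!}-\frac12\Big(\frac2{1-k}\Big)^m\frac{((1-k)\log\beta(t))^j}{j!}\right)\right),$$ and for $k=1$, $$\beta(t)=e^{-t},\qquad\alpha(t)=e^{-2t},$$ $$\mathrm{Cov}(m,t,T_1)=-e^{-2t}\left\{\frac12\frac{(-2t)^m}{m!}+\sum_{n=m+1}^\infty\frac{(-2t)^n}{n!}\right\}.$$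
   Context: $T_k$ is the infinite $(k+1)$-regular tree (connected, acyclic, every vertex of degree $k+1$). $T_k^1$ is the infinite tree in which one vertex $v_0$ has degree $1$ and all other vertices have degree $k+1$. The probability $\alpha(t)$ does not depend on $v$, and the covariance depends on $v,w$ only through their graph distance. Convention: $0^0=1$. Dimer RSA on a finite graph $V$ with edge set $E$: $\tau_e$, $e\in E$, are i.i.d. uniform on $(0,1)$. All sites are initially vacant (state $0$); at time $\tau_e$, $e=\{u,v\}$, if $u$ and $v$ are both vacant then both become occupied (state $1$); otherwise nothing changes. Occupied sites stay occupied forever. $X_t^V(v)$ is the state of $v$ at time $t$. For countably infinite $V$ of bounded degree, $X_t^V(v):=\lim_n X_t^{V_n}(v)$, where $(V_n)$ is any sequence of finite subsets of $V$ with $\bigcup_n\bigcap_{m\ge n}V_m=V$ and the process on the induced subgraph $V_n$ uses the same $\tau_e$; almost surely this limit exists for all $v,t$ and does not depend on the sequence. *)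

theory Defs
  imports "HOL-Probability.Probability"
begin

text \<open>
  Simple undirected graphs are given by a vertex set and a set of two-element edges.
  The tree notion of the AFP entry Graph_Theory concerns directed cycles of digraphs
  and does not fit here.
\<close>

definition simple_graph :: "'a set \<Rightarrow> 'a set set \<Rightarrow> bool" where
  "simple_graph V E \<longleftrightarrow> (\<forall>e\<in>E. e \<subseteq> V \<and> card e = 2)"

definition degree :: "'a set set \<Rightarrow> 'a \<Rightarrow> nat" where
  "degree E v = card {e \<in> E. v \<in> e}"

definition walk :: "'a set set \<Rightarrow> 'a list \<Rightarrow> bool" where
  "walk E xs \<longleftrightarrow> xs \<noteq> [] \<and> successively (\<lambda>x y. {x, y} \<in> E) xs"

definition connected_graph :: "'a set \<Rightarrow> 'a set set \<Rightarrow> bool" where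
  "connected_graph V E \<longleftrightarrow> (\<forall>u\<in>V. \<forall>v\<in>V. \<exists>xs. walk E xs \<and> hd xs = u \<and> last xs = v)"

definition acyclic_graph :: "'a set set \<Rightarrow> bool" where
  "acyclic_graph E \<longleftrightarrow>
     \<not> (\<exists>xs. 3 \<le> length xs \<and> distinct xs \<and> walk E xs \<and> {last xs, hd xs} \<in> E)"

definition graph_dist :: "'a set set \<Rightarrow> 'a \<Rightarrow> 'a \<Rightarrow> nat" where
  "graph_dist E u v =
     (LEAST n. \<exists>xs. walk E xs \<and> hd xs = u \<and> last xs = v \<and> length xs = Suc n)"

definition infinite_tree :: "'a set \<Rightarrow> 'a set set \<Rightarrow> bool" where
  "infinite_tree V E \<longleftrightarrow>
     simple_graph V E \<and> infinite V \<and> connected_graph V E \<and> acyclic_graph E"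

text \<open>The trees \<open>T\<^sub>k\<close> and \<open>T\<^sub>k\<^sup>1\<close>, the latter with its vertex \<open>v0\<close> of degree 1;
  each is determined up to isomorphism.\<close>

definition is_T :: "nat \<Rightarrow> 'a set \<Rightarrow> 'a set set \<Rightarrow> bool" where
  "is_T k V E \<longleftrightarrow> infinite_tree V E \<and> (\<forall>v\<in>V. degree E v = k + 1)"

definition is_T1 :: "nat \<Rightarrow> 'a set \<Rightarrow> 'a set set \<Rightarrow> 'a \<Rightarrow> bool" where
  "is_T1 k V E v0 \<longleftrightarrow> infinite_tree V E \<and> v0 \<in> V \<and> degree E v0 = 1 \<and>
     (\<forall>v\<in>V - {v0}. degree E v = k + 1)"

text \<open>
  Dimer RSA for a fixed realization \<open>\<tau>\<close> of the edge times: the set of occupied sites is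
  updated by \<open>attempt e\<close> for the edges \<open>e\<close> of the subgraph induced on the finite set \<open>W\<close>
  with \<open>\<tau> e \<le> t\<close>, in increasing order of \<open>\<tau> e\<close>. The order is only meaningful if
  \<open>\<tau>\<close> has no ties, which holds almost surely.
\<close>

definition attempt :: "'a set \<Rightarrow> 'a set \<Rightarrow> 'a set" where
  "attempt e S = (if e \<inter> S = {} then S \<union> e else S)"

definition occupied :: "'a set set \<Rightarrow> ('a set \<Rightarrow> real) \<Rightarrow> 'a set \<Rightarrow> real \<Rightarrow> 'a set" where
  "occupied E \<tau> W t =
     fold attempt (sorted_key_list_of_set \<tau> {e \<in> E. e \<subseteq> W \<and> \<tau> e \<le> t}) {}"

definition rsa_fin :: "'a set set \<Rightarrow> ('a set \<Rightarrow> real) \<Rightarrow> 'a set \<Rightarrow> real \<Rightarrow> 'a \<Rightarrow> real" where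
  "rsa_fin E \<tau> W t v = (if v \<in> occupied E \<tau> W t then 1 else 0)"

definition exhausting :: "'a set \<Rightarrow> (nat \<Rightarrow> 'a set) \<Rightarrow> bool" where
  "exhausting V Vs \<longleftrightarrow>
     (\<forall>n. finite (Vs n) \<and> Vs n \<subseteq> V) \<and> (\<Union>n. \<Inter>m\<in>{n..}. Vs m) = V"

text \<open>The process on an infinite graph, as the limit along an exhausting sequence \<open>Vs\<close>.
  Almost surely the limit exists and does not depend on \<open>Vs\<close>.\<close>

definition rsa ::
  "'a set set \<Rightarrow> ('a set \<Rightarrow> real) \<Rightarrow> (nat \<Rightarrow> 'a set) \<Rightarrow> real \<Rightarrow> 'a \<Rightarrow> real" where
  "rsa E \<tau> Vs t v = lim (\<lambda>n. rsa_fin E \<tau> (Vs n) t v)"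

definition iid_uniform :: "'w measure \<Rightarrow> 'e set \<Rightarrow> ('e \<Rightarrow> 'w \<Rightarrow> real) \<Rightarrow> bool" where
  "iid_uniform M E \<tau> \<longleftrightarrow> prob_space M \<and> prob_space.indep_vars M (\<lambda>_. borel) \<tau> E \<and>
     (\<forall>e\<in>E. distr M borel (\<tau> e) = uniform_measure lborel {0<..<1})"

definition rsa_rv ::
  "'a set set \<Rightarrow> ('a set \<Rightarrow> 'w \<Rightarrow> real) \<Rightarrow> (nat \<Rightarrow> 'a set) \<Rightarrow> real \<Rightarrow> 'a \<Rightarrow> 'w \<Rightarrow> real" where
  "rsa_rv E \<tau> Vs t v \<omega> = rsa E (\<lambda>e. \<tau> e \<omega>) Vs t v"

definition covariance :: "'w measure \<Rightarrow> ('w \<Rightarrow> real) \<Rightarrow> ('w \<Rightarrow> real) \<Rightarrow> real" where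
  "covariance M X Y =
     (\<integral>\<omega>. (X \<omega> - (\<integral>\<omega>'. X \<omega>' \<partial>M)) * (Y \<omega> - (\<integral>\<omega>'. Y \<omega>' \<partial>M)) \<partial>M)"

end

theory Submission
  imports Defs
begin

text \<open>
  A set \<open>S\<close> of vertices stops being vacant when some edge \<open>e\<close> meeting \<open>S\<close> is attempted while
  \<open>S \<union> e\<close> is vacant. This first edge is unique, and the vacancy of \<open>S \<union> e\<close> just before its time is
  decided by the other edges alone. So on a finite set \<open>F\<close> of edges the probability \<open>q F S t\<close> that
  \<open>S\<close> is vacant at time \<open>t\<close> satisfies \<open>q F S 0 = 1\<close> and
  \<open>d/dt q F S t = - (\<Sum>e. q (F - {e}) (S \<union> e) t)\<close>, the sum being over the edges \<open>e \<in> F\<close> that meet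
  \<open>S\<close> (\<open>vacant_prob_recursion\<close>). All vacancy probabilities are computed
  from this deterministic system. In particular \<open>q\<close> factorises over parts of \<open>F\<close> that meet
  only in \<open>S\<close> (\<open>vacant_prob_Un\<close>).

  A tree falls apart at each vertex into branches. For the first vertex of a branch of the
  \<open>k + 1\<close>-regular tree, recursion and factorisation give \<open>\<beta>' = - \<beta> ^ k\<close>; in a finite volume
  that contains \<open>n\<close> generations of the branch the probability differs from \<open>\<beta> t\<close> by at most
  \<open>(k t) ^ n / n!\<close> (\<open>branch_bound\<close>). Since \<open>k + 1\<close> branches meet at a vertex, \<open>\<alpha> = \<beta> ^ (k + 1)\<close>.
  For two vertices at distance \<open>m\<close> the tree consists of \<open>k\<close> branches at each of them and the segment
  between them. The probability \<open>G\<^sub>m\<close> that both ends of the segment are vacant satisfies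
  \<open>G\<^sub>m' = - 2 \<beta> ^ (k - 1) G\<^sub>m\<^sub>-\<^sub>1\<close> for \<open>m \<ge> 2\<close>, as the first hit occurs at either end and leaves a segment
  shorter by one edge with \<open>k - 1\<close> branches at its new end, and \<open>G\<^sub>1 = 1 - t\<close>
  (\<open>segment_tendsto\<close>). The covariance is \<open>\<beta> ^ (2 k) G\<^sub>m - \<alpha>\<^sup>2 = \<beta> ^ (2 k) (G\<^sub>m - \<beta>\<^sup>2)\<close>, and in the
  variable \<open>ln \<beta>\<close> the system for \<open>G\<^sub>m\<close> is solved by exponential series with finitely many terms
  cut off.

  The finite-volume limits describe the process on the infinite tree because almost surely the state
  of a vertex is eventually constant along any exhausting sequence (\<open>AE_convergence\<close>): a remote edge
  can influence it only through a walk with decreasing edge times, and with probability at least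
  \<open>1 - K ^ n / n!\<close> there is none of length \<open>n\<close>, where \<open>K\<close> bounds the degrees.
\<close>

section \<open>Filling a finite set of edges\<close>

definition fill :: "'a set set \<Rightarrow> ('a set \<Rightarrow> real) \<Rightarrow> 'a set" where
  "fill F \<tau> = fold attempt (sorted_key_list_of_set \<tau> F) {}"

definition occ :: "'a set set \<Rightarrow> ('a set \<Rightarrow> real) \<Rightarrow> real \<Rightarrow> 'a set" where
  "occ F \<tau> t = fill {e \<in> F. \<tau> e \<le> t} \<tau>"

text \<open>
  Strict inequality makes \<open>early F \<tau> (\<tau> e)\<close> the state in which the edge \<open>e\<close> is attempted.
\<close>

definition early :: "'a set set \<Rightarrow> ('a set \<Rightarrow> real) \<Rightarrow> real \<Rightarrow> 'a set" where
  "early F \<tau> s = fill {e \<in> F. \<tau> e < s} \<tau>"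

lemma occupied_eq_occ: "occupied E \<tau> W t = occ {e \<in> E. e \<subseteq> W} \<tau> t"
  unfolding occupied_def occ_def fill_def by (simp add: conj_assoc)

lemma insort_key_max:
  fixes f :: "'e \<Rightarrow> real"
  assumes "\<And>x. x \<in> set xs \<Longrightarrow> f x < f e"
  shows "insort_key f e xs = xs @ [e]"
  using assms
proof (induction xs)
  case (Cons x xs)
  then have "\<not> f e \<le> f x" by (simp add: not_le)
  then show ?case using Cons by simp
qed simp

lemma folding_on_insort_key:
  fixes \<tau> :: "'e \<Rightarrow> real"
  assumes "inj_on \<tau> S"
  shows "folding_on S (insort_key \<tau>)"
proof
  fix x y assume "x \<in> S" "y \<in> S"
  then have "insort_key \<tau> y (insort_key \<tau> x xs) = insort_key \<tau> x (insort_key \<tau> y xs)" for xs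
    using assms by (induction xs) (auto simp: inj_onD)
  then show "insort_key \<tau> y \<circ> insort_key \<tau> x = insort_key \<tau> x \<circ> insort_key \<tau> y"
    by auto
qed

lemma set_sorted_key_list_of_set_inj:
  fixes \<tau> :: "'e \<Rightarrow> real"
  assumes "finite F" "inj_on \<tau> F"
  shows "set (sorted_key_list_of_set \<tau> F) = F"
  using assms
proof (induction F)
  case (insert e F)
  have "sorted_key_list_of_set \<tau> (insert e F) = insort_key \<tau> e (sorted_key_list_of_set \<tau> F)"
    unfolding sorted_key_list_of_set_def using insert.hyps by (intro folding_on.insert[OF folding_on_insort_key[OF insert.prems]]) auto
  then show ?case
    using insert by (simp add: set_insort_key)
next
  case empty
  show ?case
    using folding_on.empty[OF folding_on_insort_key[of \<tau> "{}"], of "[]"]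
    by (simp add: sorted_key_list_of_set_def)
qed

lemma fill_insert_max:
  assumes "finite F" "inj_on \<tau> (insert e F)" "\<And>f. f \<in> F \<Longrightarrow> \<tau> f < \<tau> e"
  shows "fill (insert e F) \<tau> = attempt e (fill F \<tau>)"
proof -
  have "e \<notin> F"
    using assms(3) by blast
  then have "sorted_key_list_of_set \<tau> (insert e F) = insort_key \<tau> e (sorted_key_list_of_set \<tau> F)"
    unfolding sorted_key_list_of_set_def
    using assms(1) by (intro folding_on.insert[OF folding_on_insort_key[OF assms(2)]]) auto
  also have "\<dots> = sorted_key_list_of_set \<tau> F @ [e]"
  proof (rule insort_key_max)
    fix x assume "x \<in> set (sorted_key_list_of_set \<tau> F)"
    moreover have "inj_on \<tau> F"
      using assms(2) by (rule inj_on_subset) auto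
    ultimately show "\<tau> x < \<tau> e"
      using assms by (simp add: set_sorted_key_list_of_set_inj)
  qed
  finally show ?thesis
    by (simp add: fill_def)
qed

lemma fill_empty [simp]: "fill {} \<tau> = {}"
  using folding_on.empty[OF folding_on_insort_key[of \<tau> "{}"], of "[]"]
  by (simp add: fill_def sorted_key_list_of_set_def)

text \<open>
  Since edges are attempted in increasing order of time, adding the latest edge is one more
  attempt; statements about the filling are therefore proved by adding edges in this order.
\<close>

lemma max_edge_induct [consumes 2, case_names empty insert]:
  fixes \<tau> :: "'e \<Rightarrow> real"
  assumes "finite F" "inj_on \<tau> F" "P {}"
    and "\<And>e F. finite F \<Longrightarrow> inj_on \<tau> (insert e F) \<Longrightarrow> (\<And>f. f \<in> F \<Longrightarrow> \<tau> f < \<tau> e) \<Longrightarrow> P F \<Longrightarrow> P (insert e F)"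
  shows "P F"
  using assms(1,2)
proof (induction F rule: finite_ranking_induct[where f=\<tau>])
  case (insert x S)
  show ?case
  proof (cases "x \<in> S")
    case True
    then show ?thesis using insert by (simp add: insert_absorb)
  next
    case False
    have "P S"
      using insert inj_on_subset by blast
    moreover have "\<tau> f < \<tau> x" if "f \<in> S" for f
      using insert(2)[OF that] insert.prems that False
      by (metis inj_on_def insertI1 insertI2 less_eq_real_def)
    ultimately show ?thesis
      using insert by (intro assms(4)) auto
  qed
qed (use assms in auto)

lemma mem_fill_iff:
  assumes "finite F" "inj_on \<tau> F"
  shows "z \<in> fill F \<tau> \<longleftrightarrow> (\<exists>e\<in>F. z \<in> e \<and> e \<inter> early F \<tau> (\<tau> e) = {})"
  using assms
proof (induction rule: max_edge_induct)
  case (insert e F)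
  have 1: "early (insert e F) \<tau> (\<tau> e) = fill F \<tau>"
  proof -
    have "{f \<in> insert e F. \<tau> f < \<tau> e} = F"
      using insert(3) by auto
    then show ?thesis by (simp add: early_def)
  qed
  have 2: "early (insert e F) \<tau> (\<tau> f) = early F \<tau> (\<tau> f)" if "f \<in> F" for f
  proof -
    have "{g \<in> insert e F. \<tau> g < \<tau> f} = {g \<in> F. \<tau> g < \<tau> f}"
      using insert(3)[OF that] by auto
    then show ?thesis by (simp add: early_def)
  qed
  have 3: "(\<exists>f\<in>insert e F. z \<in> f \<and> f \<inter> early (insert e F) \<tau> (\<tau> f) = {}) \<longleftrightarrow>
      (z \<in> e \<and> e \<inter> fill F \<tau> = {}) \<or> (\<exists>f\<in>F. z \<in> f \<and> f \<inter> early F \<tau> (\<tau> f) = {})"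
    using 2 by (simp add: 1)
  have "fill (insert e F) \<tau> = attempt e (fill F \<tau>)"
    using insert(1-3) by (rule fill_insert_max)
  then have "z \<in> fill (insert e F) \<tau> \<longleftrightarrow> (z \<in> e \<and> e \<inter> fill F \<tau> = {}) \<or> z \<in> fill F \<tau>"
    by (auto simp: attempt_def)
  then show ?case
    unfolding 3 insert.IH .
qed simp

lemma mem_occ_iff:
  assumes "finite F" "inj_on \<tau> F"
  shows "z \<in> occ F \<tau> t \<longleftrightarrow> (\<exists>e\<in>F. \<tau> e \<le> t \<and> z \<in> e \<and> e \<inter> early F \<tau> (\<tau> e) = {})"
proof -
  have *: "early {e \<in> F. \<tau> e \<le> t} \<tau> (\<tau> e) = early F \<tau> (\<tau> e)" if "\<tau> e \<le> t" for e
  proof -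
    have "{f \<in> {e \<in> F. \<tau> e \<le> t}. \<tau> f < \<tau> e} = {f \<in> F. \<tau> f < \<tau> e}"
      using that by auto
    then show ?thesis by (simp add: early_def)
  qed
  show ?thesis
    unfolding occ_def using assms
    by (subst mem_fill_iff) (auto simp: * inj_on_def)
qed

lemma mem_early_iff:
  assumes "finite F" "inj_on \<tau> F"
  shows "z \<in> early F \<tau> s \<longleftrightarrow> (\<exists>e\<in>F. \<tau> e < s \<and> z \<in> e \<and> e \<inter> early F \<tau> (\<tau> e) = {})"
proof -
  have *: "early {e \<in> F. \<tau> e < s} \<tau> (\<tau> e) = early F \<tau> (\<tau> e)" if "\<tau> e < s" for e
  proof -
    have "{f \<in> {e \<in> F. \<tau> e < s}. \<tau> f < \<tau> e} = {f \<in> F. \<tau> f < \<tau> e}"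
      using that by auto
    then show ?thesis by (simp add: early_def)
  qed
  have "z \<in> early F \<tau> s \<longleftrightarrow> z \<in> fill {e \<in> F. \<tau> e < s} \<tau>"
    by (simp add: early_def)
  also have "\<dots> \<longleftrightarrow> (\<exists>e\<in>F. \<tau> e < s \<and> z \<in> e \<and> e \<inter> early F \<tau> (\<tau> e) = {})"
    using assms by (subst mem_fill_iff) (auto simp: * inj_on_def)
  finally show ?thesis .
qed

lemma occ_before_eq_early:
  assumes "inj_on \<tau> (insert e F)"
  shows "occ (F - {e}) \<tau> (\<tau> e) = early F \<tau> (\<tau> e)"
proof -
  have "{f \<in> F - {e}. \<tau> f \<le> \<tau> e} = {f \<in> F. \<tau> f < \<tau> e}"
    using assms by (auto simp: inj_on_def less_le)
  then show ?thesis by (simp add: occ_def early_def)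
qed

lemma occ_subset: "finite F \<Longrightarrow> inj_on \<tau> F \<Longrightarrow> occ F \<tau> t \<subseteq> \<Union>F"
  by (auto simp: mem_occ_iff)

text \<open>
  First-hit decomposition. If \<open>S\<close> is not vacant at time \<open>t\<close>, consider the earliest successful edge
  \<open>e\<close> that meets \<open>S\<close>. Just before it, all of \<open>S \<union> e\<close> is vacant, and conversely an edge \<open>e\<close> with
  this property does succeed. The edge itself has not acted before its own time, so the condition on
  \<open>S \<union> e\<close> may be read in the process without \<open>e\<close>: it then no longer depends on the time of \<open>e\<close>
  except as the instant of observation, which is what makes the probabilities computable.
\<close>

lemma vacant_fails_iff:
  assumes "finite F" "inj_on \<tau> F"
  shows "S \<inter> occ F \<tau> t \<noteq> {} \<longleftrightarrow>
    (\<exists>e\<in>F. e \<inter> S \<noteq> {} \<and> \<tau> e \<le> t \<and> (S \<union> e) \<inter> occ (F - {e}) \<tau> (\<tau> e) = {})"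
proof -
  define A where "A = {e \<in> F. \<tau> e \<le> t \<and> e \<inter> S \<noteq> {} \<and> e \<inter> early F \<tau> (\<tau> e) = {}}"
  have early: "occ (F - {e}) \<tau> (\<tau> e) = early F \<tau> (\<tau> e)" if "e \<in> F" for e
    using that assms by (intro occ_before_eq_early) (simp add: insert_absorb)
  show ?thesis
  proof
    assume "S \<inter> occ F \<tau> t \<noteq> {}"
    then obtain z where z: "z \<in> S" "z \<in> occ F \<tau> t" by auto
    from z(2) obtain e where "e \<in> F" "\<tau> e \<le> t" "z \<in> e" "e \<inter> early F \<tau> (\<tau> e) = {}"
      using assms by (auto simp: mem_occ_iff)
    with z(1) have "e \<in> A"
      by (auto simp: A_def)
    then have "A \<noteq> {}" by auto
    moreover have "finite A"
      using assms by (simp add: A_def)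
    ultimately obtain e where e: "e \<in> A" "\<And>f. f \<in> A \<Longrightarrow> \<tau> e \<le> \<tau> f"
      using arg_min_if_finite[of A \<tau>] by (metis not_le_imp_less)
    have "S \<inter> early F \<tau> (\<tau> e) = {}"
    proof (rule ccontr)
      assume "S \<inter> early F \<tau> (\<tau> e) \<noteq> {}"
      then obtain z where "z \<in> S" "z \<in> early F \<tau> (\<tau> e)" by auto
      then obtain f where "f \<in> F" "\<tau> f < \<tau> e" "f \<inter> S \<noteq> {}" "f \<inter> early F \<tau> (\<tau> f) = {}"
        by (subst (asm) mem_early_iff[OF assms]) auto
      then have "f \<in> A" using e(1) by (auto simp: A_def)
      then show False using e(2) \<open>\<tau> f < \<tau> e\<close> by fastforce
    qed
    then show "\<exists>e\<in>F. e \<inter> S \<noteq> {} \<and> \<tau> e \<le> t \<and> (S \<union> e) \<inter> occ (F - {e}) \<tau> (\<tau> e) = {}"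
      using e(1) early by (intro bexI[of _ e]) (auto simp: A_def)
  next
    assume "\<exists>e\<in>F. e \<inter> S \<noteq> {} \<and> \<tau> e \<le> t \<and> (S \<union> e) \<inter> occ (F - {e}) \<tau> (\<tau> e) = {}"
    then obtain e where "e \<in> F" "e \<inter> S \<noteq> {}" "\<tau> e \<le> t" "e \<inter> early F \<tau> (\<tau> e) = {}"
      using early by auto
    moreover from \<open>e \<inter> S \<noteq> {}\<close> obtain z where "z \<in> e" "z \<in> S" by auto
    ultimately have "z \<in> occ F \<tau> t"
      using assms by (subst mem_occ_iff) auto
    then show "S \<inter> occ F \<tau> t \<noteq> {}"
      using \<open>z \<in> S\<close> by auto
  qed
qed

text \<open>
  After the first hit, \<open>S\<close> is no longer vacant, so no second edge can be a first hit; the events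
  for distinct edges are disjoint and their probabilities add up.
\<close>

lemma first_hit_unique:
  assumes "finite F" "inj_on \<tau> F" "e \<in> F" "f \<in> F"
    and "e \<inter> S \<noteq> {}" "(S \<union> e) \<inter> occ (F - {e}) \<tau> (\<tau> e) = {}"
    and "f \<inter> S \<noteq> {}" "(S \<union> f) \<inter> occ (F - {f}) \<tau> (\<tau> f) = {}"
  shows "e = f"
proof -
  have *: "\<not> \<tau> g < \<tau> h"
    if "g \<in> F" "h \<in> F" "g \<inter> S \<noteq> {}" "(S \<union> g) \<inter> occ (F - {g}) \<tau> (\<tau> g) = {}"
      "(S \<union> h) \<inter> occ (F - {h}) \<tau> (\<tau> h) = {}" for g h
  proof
    assume "\<tau> g < \<tau> h"
    have "early F \<tau> (\<tau> g) = occ (F - {g}) \<tau> (\<tau> g)" "early F \<tau> (\<tau> h) = occ (F - {h}) \<tau> (\<tau> h)"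
      using that assms by (auto simp: occ_before_eq_early insert_absorb)
    moreover have "g \<subseteq> early F \<tau> (\<tau> h)"
    proof
      fix z assume "z \<in> g"
      moreover have "g \<inter> early F \<tau> (\<tau> g) = {}"
        using that(4) \<open>early F \<tau> (\<tau> g) = _\<close> by auto
      ultimately show "z \<in> early F \<tau> (\<tau> h)"
        using that(1) \<open>\<tau> g < \<tau> h\<close> by (subst mem_early_iff[OF assms(1,2)]) auto
    qed
    ultimately show False
      using that by auto
  qed
  have "\<tau> e = \<tau> f"
    using *[of e f] *[of f e] assms by auto
  then show ?thesis
    using assms by (auto simp: inj_on_def)
qed

text \<open>
  As long as \<open>x\<close> stays vacant, all attempts at edges of \<open>x\<close> fail and change nothing.
\<close>

lemma fill_delete_vertex:
  assumes "finite F" "inj_on \<tau> F" "x \<notin> fill F \<tau>"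
  shows "fill F \<tau> = fill {e \<in> F. x \<notin> e} \<tau>"
  using assms
proof (induction rule: max_edge_induct)
  case (insert e F)
  have ins: "fill (insert e F) \<tau> = attempt e (fill F \<tau>)"
    using insert(1-3) by (rule fill_insert_max)
  have IH: "fill F \<tau> = fill {e \<in> F. x \<notin> e} \<tau>"
    using insert.IH insert.prems unfolding ins by (auto simp: attempt_def split: if_splits)
  show ?case
  proof (cases "x \<in> e")
    case True
    then have "{e' \<in> insert e F. x \<notin> e'} = {e \<in> F. x \<notin> e}" by auto
    then show ?thesis
      using insert.prems True IH unfolding ins by (auto simp: attempt_def split: if_splits)
  next
    case False
    then have "{e' \<in> insert e F. x \<notin> e'} = insert e {e \<in> F. x \<notin> e}" by auto
    moreover have "fill (insert e {e \<in> F. x \<notin> e}) \<tau> = attempt e (fill {e \<in> F. x \<notin> e} \<tau>)"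
      using insert by (intro fill_insert_max) (auto simp: inj_on_def)
    ultimately show ?thesis
      using IH unfolding ins by simp
  qed
qed simp

text \<open>
  Until \<open>x\<close> is occupied, the process agrees with the one on the graph without \<open>x\<close>. This recursion
  explores the graph along walks with decreasing edge times, and is used to bound the influence of
  remote edges.
\<close>

lemma mem_occ_iff_neighbour:
  assumes "finite F" "inj_on \<tau> F" "\<And>e. e \<in> F \<Longrightarrow> card e = 2"
  shows "x \<in> occ F \<tau> t \<longleftrightarrow>
    (\<exists>y. {x, y} \<in> F \<and> \<tau> {x, y} \<le> t \<and> y \<notin> occ {e \<in> F. x \<notin> e} \<tau> (\<tau> {x, y}))"
proof -
  have del: "early F \<tau> s = early {e \<in> F. x \<notin> e} \<tau> s" if "x \<notin> early F \<tau> s" for s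
  proof -
    have "{e \<in> {e \<in> F. x \<notin> e}. \<tau> e < s} = {e \<in> {e \<in> F. \<tau> e < s}. x \<notin> e}" by auto
    moreover have "fill {e \<in> F. \<tau> e < s} \<tau> = fill {e \<in> {e \<in> F. \<tau> e < s}. x \<notin> e} \<tau>"
      using that assms(1,2) unfolding early_def by (intro fill_delete_vertex) (auto simp: inj_on_def)
    ultimately show ?thesis
      unfolding early_def by simp
  qed
  have early: "early {e \<in> F. x \<notin> e} \<tau> (\<tau> {x, y}) = occ {e \<in> F. x \<notin> e} \<tau> (\<tau> {x, y})" if "{x, y} \<in> F" for y
  proof -
    have "inj_on \<tau> (insert {x, y} {e \<in> F. x \<notin> e})"
      using that assms(2) by (auto simp: inj_on_def)
    from occ_before_eq_early[OF this] show ?thesis by simp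
  qed
  show ?thesis
  proof
    assume "x \<in> occ F \<tau> t"
    then obtain e where e: "e \<in> F" "\<tau> e \<le> t" "x \<in> e" "e \<inter> early F \<tau> (\<tau> e) = {}"
      using assms by (auto simp: mem_occ_iff)
    obtain y where y: "e = {x, y}"
      using assms(3)[OF e(1)] e(3) by (auto simp: card_2_iff)
    have "y \<notin> early {e \<in> F. x \<notin> e} \<tau> (\<tau> e)"
      using e y del[of "\<tau> e"] by auto
    then show "\<exists>y. {x, y} \<in> F \<and> \<tau> {x, y} \<le> t \<and> y \<notin> occ {e \<in> F. x \<notin> e} \<tau> (\<tau> {x, y})"
      using e y early by auto
  next
    assume "\<exists>y. {x, y} \<in> F \<and> \<tau> {x, y} \<le> t \<and> y \<notin> occ {e \<in> F. x \<notin> e} \<tau> (\<tau> {x, y})"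
    then obtain y where y: "{x, y} \<in> F" "\<tau> {x, y} \<le> t" "y \<notin> early {e \<in> F. x \<notin> e} \<tau> (\<tau> {x, y})"
      using early by auto
    show "x \<in> occ F \<tau> t"
    proof (cases "x \<in> early F \<tau> (\<tau> {x, y})")
      case True
      then obtain e where "e \<in> F" "\<tau> e < \<tau> {x, y}" "x \<in> e" "e \<inter> early F \<tau> (\<tau> e) = {}"
        by (subst (asm) mem_early_iff[OF assms(1,2)]) auto
      then show ?thesis
        using y(2) assms(1,2) by (subst mem_occ_iff) (auto intro!: bexI[of _ e])
    next
      case False
      then have "{x, y} \<inter> early F \<tau> (\<tau> {x, y}) = {}"
        using y(3) del by auto
      then show ?thesis
        using y assms(1,2) by (subst mem_occ_iff) auto
    qed
  qed
qed

section \<open>Measurability\<close>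

text \<open>
  The event that the process is in some state must be measurable on the whole probability space,
  also where two times coincide and the order of the attempts is an arbitrary choice. This holds
  because even that choice is a function of the finite comparison pattern of the times.
\<close>

lemma sorted_key_list_of_set_cong:
  fixes \<sigma> \<tau> :: "'e \<Rightarrow> real"
  assumes "\<And>e f. e \<in> F \<Longrightarrow> f \<in> F \<Longrightarrow> \<sigma> e \<le> \<sigma> f \<longleftrightarrow> \<tau> e \<le> \<tau> f"
  shows "sorted_key_list_of_set \<sigma> F = sorted_key_list_of_set \<tau> F"
proof -
  have "folding_on {} (insort_key \<sigma>)" "folding_on {} (insort_key \<tau>)"
    by (simp_all add: folding_on_def)
  note eqs = this[THEN folding_on.eq_fold]
  show ?thesis
    unfolding sorted_key_list_of_set_def eqs
  proof (rule Finite_Set.fold_closed_eq[where B = "{xs. set xs \<subseteq> F}"])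
    fix e xs assume "e \<in> F" "xs \<in> {xs. set xs \<subseteq> F}"
    then show "insort_key \<sigma> e xs = insort_key \<tau> e xs"
      using assms by (induction xs) auto
    show "insort_key \<tau> e xs \<in> {xs. set xs \<subseteq> F}"
      using \<open>e \<in> F\<close> \<open>xs \<in> _\<close> by (auto simp: set_insort_key)
  qed simp
qed

lemma occ_cong:
  assumes "\<And>e f. e \<in> F \<Longrightarrow> f \<in> F \<Longrightarrow> \<sigma> e \<le> \<sigma> f \<longleftrightarrow> \<tau> e \<le> \<tau> f"
    and "\<And>e. e \<in> F \<Longrightarrow> \<sigma> e \<le> s \<longleftrightarrow> \<tau> e \<le> t"
  shows "occ F \<sigma> s = occ F \<tau> t"
proof -
  have "{e \<in> F. \<sigma> e \<le> s} = {e \<in> F. \<tau> e \<le> t}"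
    using assms by auto
  moreover have "sorted_key_list_of_set \<sigma> {e \<in> F. \<tau> e \<le> t} = sorted_key_list_of_set \<tau> {e \<in> F. \<tau> e \<le> t}"
    using assms by (intro sorted_key_list_of_set_cong) auto
  ultimately show ?thesis
    by (simp add: occ_def fill_def)
qed

lemma occ_restrict [simp]: "occ F (restrict \<tau> F) t = occ F \<tau> t"
  by (rule occ_cong) auto

text \<open>
  The times and the instant of observation are arbitrary measurable functions here, so that the
  lemma also gives joint measurability in the instant and the times.
\<close>

lemma sets_occ:
  fixes T :: "'a set \<Rightarrow> 'w \<Rightarrow> real"
  assumes F: "finite F" and T: "\<And>e. e \<in> F \<Longrightarrow> T e \<in> borel_measurable N" and s: "s \<in> borel_measurable N"
  shows "{\<omega> \<in> space N. Q (occ F (\<lambda>e. T e \<omega>) (s \<omega>))} \<in> sets N"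
proof -
  define pat where "pat \<omega> = ({a \<in> F \<times> F. T (fst a) \<omega> \<le> T (snd a) \<omega>}, {e \<in> F. T e \<omega> \<le> s \<omega>})" for \<omega>
  define R where "R \<omega> \<longleftrightarrow> Q (occ F (\<lambda>e. T e \<omega>) (s \<omega>))" for \<omega>
  have R_cong: "R \<omega> = R \<omega>'" if "pat \<omega> = pat \<omega>'" for \<omega> \<omega>'
  proof -
    from that have 1: "{a \<in> F \<times> F. T (fst a) \<omega> \<le> T (snd a) \<omega>} = {a \<in> F \<times> F. T (fst a) \<omega>' \<le> T (snd a) \<omega>'}"
      and 2: "{e \<in> F. T e \<omega> \<le> s \<omega>} = {e \<in> F. T e \<omega>' \<le> s \<omega>'}"
      by (simp_all add: pat_def)
    have "occ F (\<lambda>e. T e \<omega>) (s \<omega>) = occ F (\<lambda>e. T e \<omega>') (s \<omega>')"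
    proof (rule occ_cong)
      fix e f assume "e \<in> F" "f \<in> F"
      then show "T e \<omega> \<le> T f \<omega> \<longleftrightarrow> T e \<omega>' \<le> T f \<omega>'"
        using eqset_imp_iff[OF 1, of "(e, f)"] by simp
      show "T e \<omega> \<le> s \<omega> \<longleftrightarrow> T e \<omega>' \<le> s \<omega>'"
        using \<open>e \<in> F\<close> eqset_imp_iff[OF 2, of e] by simp
    qed
    then show ?thesis by (simp add: R_def)
  qed
  define Ps where "Ps = {p \<in> Pow (F \<times> F) \<times> Pow F. \<exists>\<omega>\<in>space N. pat \<omega> = p \<and> R \<omega>}"
  have "finite Ps"
    using F by (simp add: Ps_def)
  have pat_in: "pat \<omega> \<in> Pow (F \<times> F) \<times> Pow F" for \<omega>
    by (auto simp: pat_def)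
  have "{\<omega> \<in> space N. R \<omega>} = (\<Union>p\<in>Ps. {\<omega> \<in> space N. pat \<omega> = p})"
  proof (intro equalityI subsetI)
    fix \<omega> assume "\<omega> \<in> {\<omega> \<in> space N. R \<omega>}"
    then have "pat \<omega> \<in> Ps" "\<omega> \<in> space N"
      using pat_in[of \<omega>] by (auto simp: Ps_def)
    then show "\<omega> \<in> (\<Union>p\<in>Ps. {\<omega> \<in> space N. pat \<omega> = p})"
      by blast
  next
    fix \<omega> assume "\<omega> \<in> (\<Union>p\<in>Ps. {\<omega> \<in> space N. pat \<omega> = p})"
    then have "pat \<omega> \<in> Ps" "\<omega> \<in> space N"
      by auto
    then obtain \<omega>' where "pat \<omega>' = pat \<omega>" "R \<omega>'"
      by (auto simp: Ps_def)
    with R_cong[of \<omega>' \<omega>] \<open>\<omega> \<in> space N\<close> show "\<omega> \<in> {\<omega> \<in> space N. R \<omega>}"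
      by simp
  qed
  also have "\<dots> \<in> sets N"
  proof (intro sets.finite_UN \<open>finite Ps\<close>)
    fix p assume "p \<in> Ps"
    then obtain A B where p: "p = (A, B)" "A \<subseteq> F \<times> F" "B \<subseteq> F"
      by (auto simp: Ps_def)
    have eq: "pat \<omega> = p \<longleftrightarrow> (\<forall>a\<in>F \<times> F. (T (fst a) \<omega> \<le> T (snd a) \<omega>) = (a \<in> A)) \<and>
        (\<forall>e\<in>F. (T e \<omega> \<le> s \<omega>) = (e \<in> B))" for \<omega>
    proof -
      have "{a \<in> F \<times> F. T (fst a) \<omega> \<le> T (snd a) \<omega>} = A \<longleftrightarrow> (\<forall>a\<in>F \<times> F. (T (fst a) \<omega> \<le> T (snd a) \<omega>) = (a \<in> A))"
        using p(2) by blast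
      moreover have "{e \<in> F. T e \<omega> \<le> s \<omega>} = B \<longleftrightarrow> (\<forall>e\<in>F. (T e \<omega> \<le> s \<omega>) = (e \<in> B))"
        using p(3) by blast
      ultimately show ?thesis
        unfolding pat_def p(1) prod.inject by blast
    qed
    have [measurable]: "finite (F \<times> F)" "finite F"
      using F by auto
    have 1[measurable]: "Measurable.pred N (\<lambda>\<omega>. T e \<omega> \<le> T f \<omega>)" if "e \<in> F" "f \<in> F" for e f
      using T[OF that(1)] T[OF that(2)] by measurable
    have 2[measurable]: "Measurable.pred N (\<lambda>\<omega>. T e \<omega> \<le> s \<omega>)" if "e \<in> F" for e
      using T[OF that(1)] s by measurable
    have "Measurable.pred N (\<lambda>\<omega>. (\<forall>a\<in>F \<times> F. (T (fst a) \<omega> \<le> T (snd a) \<omega>) = (a \<in> A)) \<and>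
        (\<forall>e\<in>F. (T e \<omega> \<le> s \<omega>) = (e \<in> B)))"
      by (intro pred_intros_logic pred_intros_finite 1 2) (auto simp: F)
    then show "{\<omega> \<in> space N. pat \<omega> = p} \<in> sets N"
      unfolding eq by (simp add: pred_def)
  qed
  finally show ?thesis
    unfolding R_def .
qed

section \<open>The recursion for vacancy probabilities\<close>

locale iid_times =
  fixes M :: "'w measure" and E :: "'a set set" and \<tau> :: "'a set \<Rightarrow> 'w \<Rightarrow> real"
  assumes iid: "iid_uniform M E \<tau>"
begin

sublocale prob_space M
  using iid by (simp add: iid_uniform_def)

lemma indep: "indep_vars (\<lambda>_. borel) \<tau> E"
  using iid by (simp add: iid_uniform_def)

lemma rv [measurable]: "e \<in> E \<Longrightarrow> \<tau> e \<in> borel_measurable M"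
  using indep by (simp add: indep_vars_def)

lemma distr_time: "e \<in> E \<Longrightarrow> distr M borel (\<tau> e) = uniform_measure lborel {0<..<1}"
  using iid by (simp add: iid_uniform_def)

lemma measurable_times:
  assumes "F \<subseteq> E"
  shows "(\<lambda>\<omega>. restrict (\<lambda>f. \<tau> f \<omega>) F) \<in> measurable M (PiM F (\<lambda>_. borel))"
  using assms by (intro measurable_restrict rv) auto

text \<open>
  Conditioning on the time of one edge: it is uniform and independent of the times of the other
  edges, so the probability is an average over its value \<open>s\<close>.
\<close>

lemma has_integral_condition_edge:
  assumes e: "e \<in> E" "e \<notin> F" and F: "F \<subseteq> E" and t: "0 \<le> t" "t \<le> 1"
    and P: "{p \<in> space (borel \<Otimes>\<^sub>M PiM F (\<lambda>_. borel)). P (fst p) (snd p)} \<in> sets (borel \<Otimes>\<^sub>M PiM F (\<lambda>_. borel))"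
  shows "((\<lambda>s. prob {\<omega> \<in> space M. P s (restrict (\<lambda>f. \<tau> f \<omega>) F)}) has_integral
      prob {\<omega> \<in> space M. \<tau> e \<omega> \<le> t \<and> P (\<tau> e \<omega>) (restrict (\<lambda>f. \<tau> f \<omega>) F)}) {0..t}"
proof -
  let ?Pi = "PiM F (\<lambda>_. borel) :: ('a set \<Rightarrow> real) measure"
  let ?Y = "\<lambda>\<omega>. restrict (\<lambda>f. \<tau> f \<omega>) F"
  let ?A = "\<lambda>s. prob {\<omega> \<in> space M. P s (?Y \<omega>)}"
  note Y[measurable] = measurable_times[OF F]
  note X[measurable] = rv[OF e(1)]
  define G where "G = {p \<in> space (borel \<Otimes>\<^sub>M ?Pi). fst p \<le> t \<and> P (fst p) (snd p)}"
  have "G = {p \<in> space (borel \<Otimes>\<^sub>M ?Pi). fst p \<le> t} \<inter> {p \<in> space (borel \<Otimes>\<^sub>M ?Pi). P (fst p) (snd p)}"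
    by (auto simp: G_def)
  then have G[measurable]: "G \<in> sets (borel \<Otimes>\<^sub>M ?Pi)"
    using P by simp
  let ?Pi1 = "PiM {e} (\<lambda>_. borel) :: ('a set \<Rightarrow> real) measure"
  let ?X = "\<lambda>\<omega>. restrict (\<lambda>f. \<tau> f \<omega>) {e}"
  have X'[measurable]: "?X \<in> measurable M ?Pi1"
    using e by (intro measurable_times) auto
  have "indep_var ?Pi1 ?X ?Pi ?Y"
    using e F by (intro indep_var_restrict[OF indep]) auto
  then have distr: "distr M ?Pi1 ?X \<Otimes>\<^sub>M distr M ?Pi ?Y = distr M (?Pi1 \<Otimes>\<^sub>M ?Pi) (\<lambda>\<omega>. (?X \<omega>, ?Y \<omega>))"
    by (simp add: indep_var_distribution_eq)
  define G' where "G' = (\<lambda>p. (fst p e, snd p)) -` G \<inter> space (?Pi1 \<Otimes>\<^sub>M ?Pi)"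
  have G'[measurable]: "G' \<in> sets (?Pi1 \<Otimes>\<^sub>M ?Pi)"
    unfolding G'_def
  proof (rule measurable_sets[OF measurable_Pair G])
    show "(\<lambda>p. snd p) \<in> measurable (?Pi1 \<Otimes>\<^sub>M ?Pi) ?Pi"
      by (rule measurable_snd)
    show "(\<lambda>p. fst p e) \<in> measurable (?Pi1 \<Otimes>\<^sub>M ?Pi) borel"
      by (rule measurable_compose[OF measurable_fst]) (simp add: measurable_component_singleton)
  qed
  interpret Y: prob_space "distr M ?Pi ?Y"
    by (rule prob_space_distr) (rule Y)
  have G'': "G' \<in> sets (distr M ?Pi1 ?X \<Otimes>\<^sub>M distr M ?Pi ?Y)"
    using G' by (simp cong: sets_pair_measure_cong)
  have sec': "Pair x -` G' = Pair (x e) -` G" if "x \<in> space ?Pi1" for x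
  proof -
    have "y \<in> space ?Pi" if "(x e, y) \<in> G" for y
      using sets.sets_into_space[OF G] that unfolding space_pair_measure by blast
    then have "(x, y) \<in> G' \<longleftrightarrow> (x e, y) \<in> G" for y
      unfolding G'_def space_pair_measure vimage_def Int_iff mem_Collect_eq mem_Times_iff fst_conv snd_conv
      using that by blast
    then show ?thesis
      by (simp add: vimage_def)
  qed
  have sec: "emeasure (distr M ?Pi ?Y) (Pair s -` G) = ennreal (indicator {..t} s * ?A s)" for s
  proof -
    have "emeasure (distr M ?Pi ?Y) (Pair s -` G) = emeasure M (?Y -` (Pair s -` G) \<inter> space M)"
      by (subst emeasure_distr) (auto intro: sets_Pair1)
    also have "?Y -` (Pair s -` G) \<inter> space M = (if s \<le> t then {\<omega> \<in> space M. P s (?Y \<omega>)} else {})"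
    proof -
      have "(s, ?Y \<omega>) \<in> G \<longleftrightarrow> s \<le> t \<and> P s (?Y \<omega>)" if "\<omega> \<in> space M" for \<omega>
        unfolding G_def space_pair_measure mem_Collect_eq mem_Times_iff fst_conv snd_conv
        using measurable_space[OF Y that] by simp
      then show ?thesis by auto
    qed
    finally have *: "emeasure (distr M ?Pi ?Y) (Pair s -` G) =
        emeasure M (if s \<le> t then {\<omega> \<in> space M. P s (?Y \<omega>)} else {})" .
    show ?thesis
      unfolding * emeasure_eq_measure by simp
  qed
  have meas: "(\<lambda>s. indicator {..t} s * ?A s) \<in> borel_measurable borel"
  proof -
    have "(\<lambda>s. emeasure (distr M ?Pi ?Y) (Pair s -` G)) \<in> borel_measurable (borel :: real measure)"
      using Y.measurable_emeasure_Pair[of G borel] G by (simp cong: sets_pair_measure_cong)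
    then have "(\<lambda>s. enn2real (emeasure (distr M ?Pi ?Y) (Pair s -` G))) \<in> borel_measurable (borel :: real measure)"
      by measurable
    then show ?thesis
      unfolding sec by simp
  qed
  let ?f = "\<lambda>s. indicator {0<..<1} s * (indicator {..t} s * ?A s)"
  have "emeasure M {\<omega> \<in> space M. \<tau> e \<omega> \<le> t \<and> P (\<tau> e \<omega>) (?Y \<omega>)}
      = emeasure (distr M (?Pi1 \<Otimes>\<^sub>M ?Pi) (\<lambda>\<omega>. (?X \<omega>, ?Y \<omega>))) G'"
  proof -
    have "(?X \<omega>, ?Y \<omega>) \<in> G' \<longleftrightarrow> \<tau> e \<omega> \<le> t \<and> P (\<tau> e \<omega>) (?Y \<omega>)" if "\<omega> \<in> space M" for \<omega>
    proof -
      have "(?X \<omega>, ?Y \<omega>) \<in> G' \<longleftrightarrow> (\<tau> e \<omega>, ?Y \<omega>) \<in> G"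
        using sec'[OF measurable_space[OF X' that]] by (auto simp: set_eq_iff)
      also have "\<dots> \<longleftrightarrow> \<tau> e \<omega> \<le> t \<and> P (\<tau> e \<omega>) (?Y \<omega>)"
        unfolding G_def space_pair_measure mem_Collect_eq mem_Times_iff fst_conv snd_conv
        using measurable_space[OF Y that] by simp
      finally show ?thesis .
    qed
    then have "{\<omega> \<in> space M. \<tau> e \<omega> \<le> t \<and> P (\<tau> e \<omega>) (?Y \<omega>)} = (\<lambda>\<omega>. (?X \<omega>, ?Y \<omega>)) -` G' \<inter> space M"
      by auto
    then show ?thesis
      by (subst emeasure_distr[OF measurable_Pair[OF X' Y] G']) simp
  qed
  also have "\<dots> = (\<integral>\<^sup>+x. emeasure (distr M ?Pi ?Y) (Pair x -` G') \<partial>distr M ?Pi1 ?X)"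
    unfolding distr[symmetric] by (rule Y.emeasure_pair_measure_alt[OF G''])
  also have "\<dots> = (\<integral>\<^sup>+x. emeasure (distr M ?Pi ?Y) (Pair (x e) -` G) \<partial>distr M ?Pi1 ?X)"
    by (intro nn_integral_cong) (simp add: sec')
  also have "\<dots> = (\<integral>\<^sup>+\<omega>. emeasure (distr M ?Pi ?Y) (Pair (\<tau> e \<omega>) -` G) \<partial>M)"
    unfolding sec using meas X' by (subst nn_integral_distr) auto
  also have "\<dots> = (\<integral>\<^sup>+s. emeasure (distr M ?Pi ?Y) (Pair s -` G) \<partial>distr M borel (\<tau> e))"
    unfolding sec using meas X by (subst nn_integral_distr) auto
  also have "\<dots> = (\<integral>\<^sup>+s. emeasure (distr M ?Pi ?Y) (Pair s -` G) \<partial>uniform_measure lborel {0<..<1})"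
    by (simp only: distr_time[OF e(1)])
  also have "\<dots> = (\<integral>\<^sup>+s. ennreal (indicator {..t} s * ?A s) * indicator {0<..<1} s \<partial>lborel)"
    unfolding sec using meas by (subst nn_integral_uniform_measure) (auto simp: divide_ennreal_def)
  also have "\<dots> = (\<integral>\<^sup>+s. ennreal (?f s) \<partial>lborel)"
    by (intro nn_integral_cong) (auto split: split_indicator)
  finally have "(\<integral>\<^sup>+s. ennreal (?f s) \<partial>lborel) = ennreal (prob {\<omega> \<in> space M. \<tau> e \<omega> \<le> t \<and> P (\<tau> e \<omega>) (?Y \<omega>)})"
    by (simp add: emeasure_eq_measure)
  then have "(?f has_integral prob {\<omega> \<in> space M. \<tau> e \<omega> \<le> t \<and> P (\<tau> e \<omega>) (?Y \<omega>)}) UNIV"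
    using meas by (intro nn_integral_has_integral) (auto intro!: mult_nonneg_nonneg)
  then have "((\<lambda>s. if s \<in> {0..t} then ?A s else 0) has_integral prob {\<omega> \<in> space M. \<tau> e \<omega> \<le> t \<and> P (\<tau> e \<omega>) (?Y \<omega>)}) UNIV"
    by (rule has_integral_spike_finite[of "{0, 1}", rotated 2]) (use t in \<open>auto split: split_indicator\<close>)
  then show ?thesis
    by (simp only: has_integral_restrict_UNIV)
qed

lemma AE_time_interval: "e \<in> E \<Longrightarrow> AE \<omega> in M. 0 < \<tau> e \<omega> \<and> \<tau> e \<omega> < 1"
proof -
  assume e: "e \<in> E"
  have "AE x in uniform_measure lborel {0<..<1}. 0 < x \<and> x < (1::real)"
    by (intro AE_uniform_measureI) auto
  then have "AE x in distr M borel (\<tau> e). 0 < x \<and> x < 1"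
    by (subst distr_time[OF e])
  then show ?thesis
    using rv[OF e] by (subst (asm) AE_distr_iff) auto
qed

lemma AE_no_tie:
  assumes "e \<in> E" "f \<in> E" "e \<noteq> f"
  shows "AE \<omega> in M. \<tau> e \<omega> \<noteq> \<tau> f \<omega>"
proof -
  note [measurable] = rv[OF assms(1)] rv[OF assms(2)]
  have 0: "prob {\<omega> \<in> space M. restrict (\<lambda>f. \<tau> f \<omega>) {f} f = s} = 0" for s
  proof -
    have "prob {\<omega> \<in> space M. \<tau> f \<omega> = s} = measure (distr M borel (\<tau> f)) {s}"
      by (subst measure_distr) (auto intro!: arg_cong2[where f=measure])
    also have "\<dots> = 0"
      unfolding distr_time[OF assms(2)]
      by (subst measure_uniform_measure) (auto intro!: measure_eq_0_null_sets finite_imp_null_set_lborel)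
    finally show ?thesis by simp
  qed
  \<comment> \<open>Given the time of \<open>e\<close>, the time of \<open>f\<close> hits that single value with probability 0.\<close>
  have "((\<lambda>s. prob {\<omega> \<in> space M. restrict (\<lambda>f. \<tau> f \<omega>) {f} f = s}) has_integral
      prob {\<omega> \<in> space M. \<tau> e \<omega> \<le> 1 \<and> restrict (\<lambda>f. \<tau> f \<omega>) {f} f = \<tau> e \<omega>}) {0..1}"
    using assms by (intro has_integral_condition_edge[where P = "\<lambda>s x. x f = s"]) auto
  then have "prob {\<omega> \<in> space M. \<tau> e \<omega> \<le> 1 \<and> \<tau> f \<omega> = \<tau> e \<omega>} = 0"
    unfolding 0 by (simp add: has_integral_iff)
  then have "AE \<omega> in M. \<not> (\<tau> e \<omega> \<le> 1 \<and> \<tau> f \<omega> = \<tau> e \<omega>)"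
    by (subst (asm) prob_eq_0) auto
  with AE_time_interval[OF assms(1)] show ?thesis
    by eventually_elim auto
qed

lemma AE_inj_on:
  assumes "countable F" "F \<subseteq> E"
  shows "AE \<omega> in M. inj_on (\<lambda>e. \<tau> e \<omega>) F"
proof -
  have "AE \<omega> in M. \<forall>e\<in>F. \<forall>f\<in>F. e \<noteq> f \<longrightarrow> \<tau> e \<omega> \<noteq> \<tau> f \<omega>"
    using assms AE_no_tie by (subst AE_ball_countable, simp)+ (auto simp: AE_ball_countable)
  then show ?thesis
    by eventually_elim (auto simp: inj_on_def)
qed

definition vacant_prob :: "'a set set \<Rightarrow> 'a set \<Rightarrow> real \<Rightarrow> real" where
  "vacant_prob F S t = prob {\<omega> \<in> space M. S \<inter> occ F (\<lambda>e. \<tau> e \<omega>) t = {}}"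

lemma vacant_prob_nonneg [simp]: "0 \<le> vacant_prob F S t"
  and vacant_prob_le_1 [simp]: "vacant_prob F S t \<le> 1"
  by (simp_all add: vacant_prob_def)

lemma sets_occ_const:
  assumes "finite F" "F \<subseteq> E"
  shows "{\<omega> \<in> space M. Q (occ F (\<lambda>e. \<tau> e \<omega>) t)} \<in> sets M"
  using assms by (intro sets_occ rv) auto

lemma has_integral_vacant_prob:
  assumes "e \<in> E" "e \<notin> F" "finite F" "F \<subseteq> E" "0 \<le> t" "t \<le> 1"
  shows "((\<lambda>s. vacant_prob F S s) has_integral
    prob {\<omega> \<in> space M. \<tau> e \<omega> \<le> t \<and> S \<inter> occ F (\<lambda>e. \<tau> e \<omega>) (\<tau> e \<omega>) = {}}) {0..t}"
proof -
  have "((\<lambda>s. prob {\<omega> \<in> space M. S \<inter> occ F (restrict (\<lambda>f. \<tau> f \<omega>) F) s = {}}) has_integral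
      prob {\<omega> \<in> space M. \<tau> e \<omega> \<le> t \<and> S \<inter> occ F (restrict (\<lambda>f. \<tau> f \<omega>) F) (\<tau> e \<omega>) = {}}) {0..t}"
    using assms
    by (intro has_integral_condition_edge[where P = "\<lambda>s x. S \<inter> occ F x s = {}"] sets_occ) auto
  then show ?thesis
    by (simp add: vacant_prob_def)
qed

text \<open>
  The first-hit decomposition in expectation; the ties excluded there have probability 0.
\<close>

lemma vacant_prob_recursion:
  assumes F: "finite F" "F \<subseteq> E" and t: "0 \<le> t" "t \<le> 1"
  shows "vacant_prob F S t =
    1 - (\<Sum>e | e \<in> F \<and> e \<inter> S \<noteq> {}. integral {0..t} (vacant_prob (F - {e}) (S \<union> e)))"
proof -
  let ?I = "{e \<in> F. e \<inter> S \<noteq> {}}"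
  let ?Y = "\<lambda>e. {\<omega> \<in> space M. \<tau> e \<omega> \<le> t \<and> (S \<union> e) \<inter> occ (F - {e}) (\<lambda>e. \<tau> e \<omega>) (\<tau> e \<omega>) = {}}"
  let ?X = "{\<omega> \<in> space M. S \<inter> occ F (\<lambda>e. \<tau> e \<omega>) t \<noteq> {}}"
  have X[measurable]: "?X \<in> events"
    using F by (rule sets_occ_const)
  have Y[measurable]: "?Y e \<in> events" if "e \<in> F" for e
  proof -
    have "{\<omega> \<in> space M. \<tau> e \<omega> \<le> t} \<in> events"
      using rv[of e] F that by auto
    moreover have "{\<omega> \<in> space M. (S \<union> e) \<inter> occ (F - {e}) (\<lambda>e. \<tau> e \<omega>) (\<tau> e \<omega>) = {}} \<in> events"
      using F that by (intro sets_occ rv) auto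
    ultimately have "{\<omega> \<in> space M. \<tau> e \<omega> \<le> t} \<inter> {\<omega> \<in> space M. (S \<union> e) \<inter> occ (F - {e}) (\<lambda>e. \<tau> e \<omega>) (\<tau> e \<omega>) = {}} \<in> events"
      by (rule sets.Int)
    also have "{\<omega> \<in> space M. \<tau> e \<omega> \<le> t} \<inter> {\<omega> \<in> space M. (S \<union> e) \<inter> occ (F - {e}) (\<lambda>e. \<tau> e \<omega>) (\<tau> e \<omega>) = {}} = ?Y e"
      by auto
    finally show ?thesis .
  qed
  have "AE \<omega> in M. inj_on (\<lambda>e. \<tau> e \<omega>) F"
    using F by (intro AE_inj_on countable_finite) auto
  then have AE: "AE \<omega> in M. indicator ?X \<omega> = (\<Sum>e\<in>?I. indicator (?Y e) \<omega> :: real)"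
    using AE_space
  proof eventually_elim
    case (elim \<omega>)
    let ?\<tau> = "\<lambda>e. \<tau> e \<omega>"
    let ?A = "{e \<in> F. e \<inter> S \<noteq> {} \<and> ?\<tau> e \<le> t \<and> (S \<union> e) \<inter> occ (F - {e}) ?\<tau> (?\<tau> e) = {}}"
    have "(\<Sum>e\<in>?I. indicator (?Y e) \<omega> :: real) = (\<Sum>e\<in>?A. 1)"
      using F elim(2) by (intro sum.mono_neutral_cong_right) (auto simp: indicator_def)
    also have "\<dots> = (if ?A = {} then 0 else 1)"
    proof (cases "?A = {}")
      case False
      then obtain e where e: "e \<in> ?A" by blast
      have "f = e" if "f \<in> ?A" for f
        using first_hit_unique[OF F(1) elim(1), of f e S] that e by auto
      then have "?A = {e}" using e by blast
      then show ?thesis by simp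
    next
      case True
      then show ?thesis unfolding True by simp
    qed
    also have "?A = {} \<longleftrightarrow> S \<inter> occ F ?\<tau> t = {}"
      using vacant_fails_iff[OF F(1) elim(1), of S t] by auto
    finally show ?case
      using elim(2) by (simp add: indicator_def)
  qed
  have "prob ?X = (\<integral>\<omega>. indicator ?X \<omega> \<partial>M)"
    by simp
  also have "\<dots> = (\<integral>\<omega>. (\<Sum>e\<in>?I. indicator (?Y e) \<omega>) \<partial>M)"
    using AE Y by (intro integral_cong_AE) auto
  also have "\<dots> = (\<Sum>e\<in>?I. (\<integral>\<omega>. indicator (?Y e) \<omega> \<partial>M))"
    using Y by (intro Bochner_Integration.integral_sum) (auto simp: less_top[symmetric])
  also have "\<dots> = (\<Sum>e\<in>?I. integral {0..t} (vacant_prob (F - {e}) (S \<union> e)))"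
  proof (intro sum.cong refl)
    fix e assume e: "e \<in> ?I"
    then have "(vacant_prob (F - {e}) (S \<union> e) has_integral prob (?Y e)) {0..t}"
      using F t by (intro has_integral_vacant_prob) auto
    then show "(\<integral>\<omega>. indicator (?Y e) \<omega> \<partial>M) = integral {0..t} (vacant_prob (F - {e}) (S \<union> e))"
      using Y e by (simp add: has_integral_iff)
  qed
  finally have "prob ?X = \<dots>" .
  moreover have "vacant_prob F S t = 1 - prob ?X"
    unfolding vacant_prob_def using prob_neg[of "\<lambda>\<omega>. S \<inter> occ F (\<lambda>e. \<tau> e \<omega>) t = {}"] sets_occ_const[OF F]
    by simp
  ultimately show ?thesis by simp
qed

lemma vacant_prob_0: "finite F \<Longrightarrow> F \<subseteq> E \<Longrightarrow> vacant_prob F S 0 = 1"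
  by (subst vacant_prob_recursion) auto

lemma vacant_prob_integrable:
  assumes "e \<in> E" "e \<notin> F" "finite F" "F \<subseteq> E" "0 \<le> t" "t \<le> 1"
  shows "vacant_prob F S integrable_on {0..t}"
  using has_integral_vacant_prob[OF assms] by (auto simp: integrable_on_def)

lemma continuous_on_vacant_prob:
  assumes F: "finite F" "F \<subseteq> E"
  shows "continuous_on {0..1} (vacant_prob F S)"
proof -
  have "continuous_on {0..1} (\<lambda>t. 1 - (\<Sum>e | e \<in> F \<and> e \<inter> S \<noteq> {}. integral {0..t} (vacant_prob (F - {e}) (S \<union> e))))"
    using F by (intro continuous_intros indefinite_integral_continuous_1 vacant_prob_integrable) auto
  then show ?thesis
    by (subst continuous_on_cong[OF refl vacant_prob_recursion[OF F]]) auto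
qed

lemma has_derivative_vacant_prob:
  assumes F: "finite F" "F \<subseteq> E" and t: "t \<in> {0..1}"
  shows "(vacant_prob F S has_real_derivative
    - (\<Sum>e | e \<in> F \<and> e \<inter> S \<noteq> {}. vacant_prob (F - {e}) (S \<union> e) t)) (at t within {0..1})"
proof (rule has_field_derivative_transform_within[where d = 1])
  show "((\<lambda>t. 1 - (\<Sum>e | e \<in> F \<and> e \<inter> S \<noteq> {}. integral {0..t} (vacant_prob (F - {e}) (S \<union> e))))
    has_real_derivative
    - (\<Sum>e | e \<in> F \<and> e \<inter> S \<noteq> {}. vacant_prob (F - {e}) (S \<union> e) t)) (at t within {0..1})"
    using F t
    by (auto intro!: derivative_eq_intros integral_has_real_derivative continuous_on_vacant_prob)
qed (use t F in \<open>auto simp: vacant_prob_recursion\<close>)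

end

section \<open>Factorisation at vacant sites\<close>

context iid_times
begin

lemma vacant_prob_empty [simp]:
  assumes "t \<in> {0..1}"
  shows "vacant_prob {} S t = 1"
  using assms by (subst vacant_prob_recursion) auto

lemma vacant_prob_cong_sites:
  assumes F: "finite F" "F \<subseteq> E" and S: "S \<inter> \<Union>F = S' \<inter> \<Union>F"
  shows "vacant_prob F S t = vacant_prob F S' t"
  unfolding vacant_prob_def
proof (rule finite_measure_eq_AE)
  have "AE \<omega> in M. inj_on (\<lambda>e. \<tau> e \<omega>) F"
    using F by (intro AE_inj_on countable_finite) auto
  then show "AE \<omega> in M. \<omega> \<in> {\<omega> \<in> space M. S \<inter> occ F (\<lambda>e. \<tau> e \<omega>) t = {}} \<longleftrightarrow>
      \<omega> \<in> {\<omega> \<in> space M. S' \<inter> occ F (\<lambda>e. \<tau> e \<omega>) t = {}}"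
  proof eventually_elim
    case (elim \<omega>)
    have "occ F (\<lambda>e. \<tau> e \<omega>) t \<subseteq> \<Union>F"
      using F(1) elim by (rule occ_subset)
    then show ?case using S by auto
  qed
qed (use F in \<open>auto intro: sets_occ_const\<close>)

text \<open>
  Pieces of the graph that meet only in sites of \<open>S\<close> do not interact while \<open>S\<close> is vacant. In terms
  of the recursion: by induction on the number of edges, both sides have the same derivative (the
  product rule splits the first hit into a hit from either piece) and the same value 1 at time 0.
\<close>

lemma vacant_prob_Un:
  assumes "finite F1" "F1 \<subseteq> E" "finite F2" "F2 \<subseteq> E" "F1 \<inter> F2 = {}" "\<Union>F1 \<inter> \<Union>F2 \<subseteq> S" "t \<in> {0..1}"
  shows "vacant_prob (F1 \<union> F2) S t = vacant_prob F1 S t * vacant_prob F2 S t"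
  using assms
proof (induction "card F1 + card F2" arbitrary: F1 F2 S t rule: less_induct)
  case less
  note F = less.prems(1-6)
  let ?q = vacant_prob
  let ?h = "\<lambda>t. ?q (F1 \<union> F2) S t - ?q F1 S t * ?q F2 S t"
  have "(?h has_real_derivative 0) (at t within {0..1})" if t: "t \<in> {0..1}" for t
  proof -
    have 1: "?q (F1 \<union> F2 - {e}) (S \<union> e) t = ?q (F1 - {e}) (S \<union> e) t * ?q F2 S t" if e: "e \<in> F1" for e
    proof -
      have "e \<notin> F2" "F1 \<union> F2 - {e} = (F1 - {e}) \<union> F2"
        using e F(5) by auto
      moreover have card: "card (F1 - {e}) < card F1"
        using F e by (intro card_Diff1_less) auto
      moreover have "?q ((F1 - {e}) \<union> F2) (S \<union> e) t = ?q (F1 - {e}) (S \<union> e) t * ?q F2 (S \<union> e) t"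
        using F e t card by (intro less.hyps) auto
      moreover have "?q F2 (S \<union> e) t = ?q F2 S t"
        using F e by (intro vacant_prob_cong_sites) auto
      ultimately show ?thesis by simp
    qed
    have 2: "?q (F1 \<union> F2 - {e}) (S \<union> e) t = ?q F1 S t * ?q (F2 - {e}) (S \<union> e) t" if e: "e \<in> F2" for e
    proof -
      have "e \<notin> F1" "F1 \<union> F2 - {e} = F1 \<union> (F2 - {e})"
        using e F(5) by auto
      moreover have card: "card (F2 - {e}) < card F2"
        using F e by (intro card_Diff1_less) auto
      moreover have "?q (F1 \<union> (F2 - {e})) (S \<union> e) t = ?q F1 (S \<union> e) t * ?q (F2 - {e}) (S \<union> e) t"
        using F e t card by (intro less.hyps) auto
      moreover have "?q F1 (S \<union> e) t = ?q F1 S t"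
        using F e by (intro vacant_prob_cong_sites) auto
      ultimately show ?thesis by simp
    qed
    have "{e \<in> F1 \<union> F2. e \<inter> S \<noteq> {}} = {e \<in> F1. e \<inter> S \<noteq> {}} \<union> {e \<in> F2. e \<inter> S \<noteq> {}}"
      by auto
    then have "(\<Sum>e | e \<in> F1 \<union> F2 \<and> e \<inter> S \<noteq> {}. ?q (F1 \<union> F2 - {e}) (S \<union> e) t) =
      (\<Sum>e | e \<in> F1 \<and> e \<inter> S \<noteq> {}. ?q (F1 \<union> F2 - {e}) (S \<union> e) t) +
      (\<Sum>e | e \<in> F2 \<and> e \<inter> S \<noteq> {}. ?q (F1 \<union> F2 - {e}) (S \<union> e) t)"
      using F by (simp only:) (subst sum.union_disjoint, auto)
    also have "\<dots> = (\<Sum>e | e \<in> F1 \<and> e \<inter> S \<noteq> {}. ?q (F1 - {e}) (S \<union> e) t) * ?q F2 S t +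
      ?q F1 S t * (\<Sum>e | e \<in> F2 \<and> e \<inter> S \<noteq> {}. ?q (F2 - {e}) (S \<union> e) t)"
      using 1 2 by (simp add: sum_distrib_left sum_distrib_right)
    finally have sum: "(\<Sum>e | e \<in> F1 \<union> F2 \<and> e \<inter> S \<noteq> {}. ?q (F1 \<union> F2 - {e}) (S \<union> e) t) = \<dots>" .
    have "(?h has_real_derivative
        - (\<Sum>e | e \<in> F1 \<union> F2 \<and> e \<inter> S \<noteq> {}. ?q (F1 \<union> F2 - {e}) (S \<union> e) t)
        - (- (\<Sum>e | e \<in> F1 \<and> e \<inter> S \<noteq> {}. ?q (F1 - {e}) (S \<union> e) t) * ?q F2 S t
           + - (\<Sum>e | e \<in> F2 \<and> e \<inter> S \<noteq> {}. ?q (F2 - {e}) (S \<union> e) t) * ?q F1 S t)) (at t within {0..1})"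
      using F t by (intro DERIV_diff DERIV_mult has_derivative_vacant_prob) auto
    then show ?thesis
      unfolding sum by (simp add: algebra_simps)
  qed
  then obtain c where c: "\<And>t. t \<in> {0..1} \<Longrightarrow> ?h t = c"
    using has_field_derivative_zero_constant[of "{0..1}" ?h] by auto
  have "?h 0 = 0"
    using F by (simp add: vacant_prob_0)
  then show ?case
    using c[of 0] c[of t] less.prems(7) by simp
qed

lemma vacant_prob_UN:
  assumes "finite I" "\<And>i. i \<in> I \<Longrightarrow> finite (A i)" "\<And>i. i \<in> I \<Longrightarrow> A i \<subseteq> E"
    and "\<And>i j. i \<in> I \<Longrightarrow> j \<in> I \<Longrightarrow> i \<noteq> j \<Longrightarrow> A i \<inter> A j = {}"
    and "\<And>i j. i \<in> I \<Longrightarrow> j \<in> I \<Longrightarrow> i \<noteq> j \<Longrightarrow> \<Union>(A i) \<inter> \<Union>(A j) \<subseteq> S"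
    and "t \<in> {0..1}"
  shows "vacant_prob (\<Union>i\<in>I. A i) S t = (\<Prod>i\<in>I. vacant_prob (A i) S t)"
  using assms
proof (induction I)
  case (insert i I)
  have "vacant_prob (A i \<union> (\<Union>i\<in>I. A i)) S t = vacant_prob (A i) S t * vacant_prob (\<Union>i\<in>I. A i) S t"
  proof (rule vacant_prob_Un)
    show "A i \<inter> \<Union> (A ` I) = {}"
      using insert.prems(3)[of i] insert.hyps by blast
    have "\<Union> (A i) \<inter> \<Union> (A j) \<subseteq> S" if "j \<in> I" for j
      using insert.prems(4)[of i j] insert.hyps that by blast
    then show "\<Union> (A i) \<inter> \<Union> (\<Union> (A ` I)) \<subseteq> S"
      by blast
  qed (use insert.prems insert.hyps in auto)
  also have "vacant_prob (\<Union>i\<in>I. A i) S t = (\<Prod>i\<in>I. vacant_prob (A i) S t)"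
    using insert.prems by (intro insert.IH) auto
  finally show ?case
    using insert.hyps by simp
qed simp

end

section \<open>Non-backtracking walks and branches of a forest\<close>

definition nb_walk :: "'a set set \<Rightarrow> 'a list \<Rightarrow> bool" where
  "nb_walk E xs \<longleftrightarrow> successively (\<lambda>x y. {x, y} \<in> E) xs \<and>
     (\<forall>i. i + 2 < length xs \<longrightarrow> xs ! i \<noteq> xs ! (i + 2))"

lemma nb_walk_join:
  assumes "nb_walk E (as @ [y])" "nb_walk E (y # bs)" "as \<noteq> [] \<Longrightarrow> bs \<noteq> [] \<Longrightarrow> last as \<noteq> hd bs"
  shows "nb_walk E (as @ y # bs)"
proof -
  have "(as @ y # bs) ! i \<noteq> (as @ y # bs) ! (i + 2)" if i: "i + 2 < length (as @ y # bs)" for i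
  proof -
    consider "i + 2 \<le> length as" | "i + 1 = length as" | "i \<ge> length as"
      by linarith
    then show ?thesis
    proof cases
      case 1
      then have "(as @ [y]) ! i \<noteq> (as @ [y]) ! (i + 2)"
        using assms(1) unfolding nb_walk_def by simp
      then show ?thesis
        using 1 by (cases "i + 2 = length as") (auto simp: nth_append)
    next
      case 2
      then have "as \<noteq> []" "bs \<noteq> []" using i by auto
      moreover have "(as @ y # bs) ! i = last as"
        using 2 \<open>as \<noteq> []\<close> by (auto simp: nth_append last_conv_nth simp flip: 2)
      moreover have "(as @ y # bs) ! (i + 2) = hd bs"
        using 2 \<open>bs \<noteq> []\<close> by (auto simp: nth_append hd_conv_nth simp flip: 2)
      ultimately show ?thesis
        using assms(3) by simp
    next
      case 3
      then obtain j where j: "i = length as + j"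
        using le_Suc_ex by blast
      then have "(y # bs) ! j \<noteq> (y # bs) ! (j + 2)"
        using assms(2) i unfolding nb_walk_def by simp
      then show ?thesis
        by (simp add: j nth_append)
    qed
  qed
  then show ?thesis
    using assms(1,2) by (auto simp: nb_walk_def successively_append_iff successively_Cons)
qed

lemma nb_walk_ConsD: "nb_walk E (x # xs) \<Longrightarrow> nb_walk E xs"
  unfolding nb_walk_def by (force simp: successively_Cons dest: spec[of _ "Suc _"])

lemma nb_walk_two [simp]: "nb_walk E [x, y] \<longleftrightarrow> {x, y} \<in> E"
  by (auto simp: nb_walk_def)

text \<open>
  All tree geometry below is derived from one property: in a graph without cycles a walk that never
  immediately turns back cannot visit a vertex twice.
\<close>

locale forest =
  fixes E :: "'a set set"
  assumes card_edge: "e \<in> E \<Longrightarrow> card e = 2"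
    and acyclic: "acyclic_graph E"
begin

lemma edge_neq: "{x, y} \<in> E \<Longrightarrow> x \<noteq> y"
  using card_edge[of "{x, y}"] by auto

lemma nb_walk_distinct: "nb_walk E xs \<Longrightarrow> distinct xs"
proof (induction xs)
  case (Cons x ys)
  have "distinct ys"
    by (rule Cons.IH[OF nb_walk_ConsD[OF Cons.prems]])
  moreover have "x \<notin> set ys"
  proof
    assume "x \<in> set ys"
    then obtain as bs where ys: "ys = as @ x # bs" "x \<notin> set as"
      by (meson split_list_first)
    have walk: "successively (\<lambda>x y. {x, y} \<in> E) (x # as @ x # bs)"
      using Cons.prems by (simp add: nb_walk_def ys)
    have "as \<noteq> []"
      using walk edge_neq[of x x] by auto
    moreover have "as \<noteq> [a]" for a
      using Cons.prems unfolding nb_walk_def by (auto simp: ys dest: spec[of _ 0])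
    ultimately have "3 \<le> length (x # as)"
      by (cases as; cases "tl as") auto
    moreover have "distinct (x # as)"
      using ys \<open>distinct ys\<close> by auto
    moreover have "walk E (x # as)"
      using walk \<open>as \<noteq> []\<close> by (simp add: walk_def successively_Cons successively_append_iff)
    moreover have "{last (x # as), hd (x # as)} \<in> E"
      using walk \<open>as \<noteq> []\<close> by (simp add: successively_Cons successively_append_iff)
    ultimately show False
      using acyclic unfolding acyclic_graph_def by blast
  qed
  ultimately show ?case by simp
qed simp

end

text \<open>
  A dart is a directed edge. \<open>dart_path E x y n a b\<close> says that a non-backtracking walk whose first
  step is \<open>(x, y)\<close> makes \<open>n\<close> further steps, the last step being \<open>(a, b)\<close>; the distance of \<open>x\<close> and \<open>b\<close>
  in a tree is then \<open>n + 1\<close>.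
\<close>

inductive dart_path :: "'a set set \<Rightarrow> 'a \<Rightarrow> 'a \<Rightarrow> nat \<Rightarrow> 'a \<Rightarrow> 'a \<Rightarrow> bool" for E x y where
  start: "{x, y} \<in> E \<Longrightarrow> dart_path E x y 0 x y"
| step: "dart_path E x y n a b \<Longrightarrow> {b, c} \<in> E \<Longrightarrow> c \<noteq> a \<Longrightarrow> dart_path E x y (Suc n) b c"

text \<open>
  In a tree, \<open>branch E x y\<close> is the part hanging off \<open>x\<close> through the edge \<open>{x, y}\<close>, that edge
  included. In the \<open>k + 1\<close>-regular tree it is a copy of the tree with one vertex of degree 1.
\<close>

definition branch :: "'a set set \<Rightarrow> 'a \<Rightarrow> 'a \<Rightarrow> 'a set set" where
  "branch E x y = {{a, b} | a b. \<exists>n. dart_path E x y n a b}"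

definition nbrs :: "'a set set \<Rightarrow> 'a \<Rightarrow> 'a set" where
  "nbrs E v = {c. {v, c} \<in> E}"

lemma dart_path_edge: "dart_path E x y n a b \<Longrightarrow> {a, b} \<in> E"
  by (induction rule: dart_path.induct) auto

lemma dart_path_edge_start: "dart_path E x y n a b \<Longrightarrow> {x, y} \<in> E"
  by (induction rule: dart_path.induct) auto

lemma dart_path_cons:
  assumes "dart_path E y c n a b" "{x, y} \<in> E" "c \<noteq> x"
  shows "dart_path E x y (Suc n) a b"
  using assms
  by (induction rule: dart_path.induct) (auto intro: dart_path.intros)

lemma dart_path_trans:
  assumes "dart_path E c d m a b" "dart_path E x y n c d"
  shows "dart_path E x y (n + m) a b"
  using assms by (induction rule: dart_path.induct) (auto intro: dart_path.intros)

lemma dart_path_rev: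
  assumes "dart_path E x y n a b"
  shows "dart_path E b a n y x"
  using assms
proof (induction rule: dart_path.induct)
  case start
  then show ?case by (auto intro: dart_path.start simp: insert_commute)
next
  case (step n a b c)
  then show ?case by (auto intro: dart_path_cons simp: insert_commute)
qed

lemma dart_path_SucE:
  assumes "dart_path E x y (Suc n) a b"
  obtains c where "c \<noteq> x" "{y, c} \<in> E" "dart_path E y c n a b"
proof -
  have "m = Suc n \<Longrightarrow> \<exists>c. c \<noteq> x \<and> {y, c} \<in> E \<and> dart_path E y c n a b" if "dart_path E x y m a b" for m
    using that
  proof (induction arbitrary: n rule: dart_path.induct)
    case (step m a b c)
    show ?case
    proof (cases m)
      case 0
      with step(1) have "a = x" "b = y" by (auto elim: dart_path.cases)
      with step 0 show ?thesis by (auto intro!: exI[of _ c] dart_path.start)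
    next
      case (Suc m')
      with step obtain d where "d \<noteq> x" "{y, d} \<in> E" "dart_path E y d m' a b" by blast
      with step Suc show ?thesis by (auto intro!: exI[of _ d] dart_path.step)
    qed
  qed simp
  with assms that show ?thesis by blast
qed

lemma dart_path_nb_walk:
  assumes "dart_path E x y n a b"
  shows "\<exists>ws vs. nb_walk E (x # y # ws) \<and> x # y # ws = vs @ [a, b]"
  using assms
proof (induction rule: dart_path.induct)
  case start
  then show ?case by (intro exI[of _ "[]"]) auto
next
  case (step n a b c)
  then obtain ws vs where w: "nb_walk E (x # y # ws)" "x # y # ws = vs @ [a, b]" by blast
  have "nb_walk E ((vs @ [a]) @ [b])"
    using w(1) unfolding w(2) by simp
  then have "nb_walk E ((vs @ [a]) @ b # [c])"
    by (rule nb_walk_join) (use step.hyps in simp_all)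
  moreover have "x # y # (ws @ [c]) = (vs @ [a]) @ b # [c]"
    using arg_cong[OF w(2), of "\<lambda>xs. xs @ [c]"] by simp
  ultimately have "nb_walk E (x # y # (ws @ [c])) \<and> x # y # (ws @ [c]) = (vs @ [a]) @ [b, c]"
    by (simp only: simp_thms)
  then show ?case by blast
qed

lemma branch_start: "{x, y} \<in> E \<Longrightarrow> {x, y} \<in> branch E x y"
  by (auto simp: branch_def intro: dart_path.start)

lemma branch_subset: "branch E x y \<subseteq> E"
  by (auto simp: branch_def dest: dart_path_edge)

lemma branch_subset_branch: "dart_path E x y n a b \<Longrightarrow> branch E a b \<subseteq> branch E x y"
  unfolding branch_def using dart_path_trans by fast

lemma branch_unfold:
  assumes "{x, y} \<in> E"
  shows "branch E x y = insert {x, y} (\<Union>c\<in>nbrs E y - {x}. branch E y c)"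
proof
  show "branch E x y \<subseteq> insert {x, y} (\<Union>c\<in>nbrs E y - {x}. branch E y c)"
  proof
    fix e assume "e \<in> branch E x y"
    then obtain n a b where n: "dart_path E x y n a b" "e = {a, b}"
      by (auto simp: branch_def)
    show "e \<in> insert {x, y} (\<Union>c\<in>nbrs E y - {x}. branch E y c)"
    proof (cases n)
      case 0
      with n show ?thesis by (auto elim: dart_path.cases)
    next
      case (Suc m)
      with n obtain c where "c \<noteq> x" "{y, c} \<in> E" "dart_path E y c m a b"
        by (auto elim: dart_path_SucE)
      with n show ?thesis by (auto simp: branch_def nbrs_def)
    qed
  qed
  have "branch E y c \<subseteq> branch E x y" if "c \<in> nbrs E y - {x}" for c
    using that assms by (intro branch_subset_branch[where n = 1]) (auto simp: nbrs_def intro: dart_path_cons[where n = 0, simplified] dart_path.start)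
  then show "insert {x, y} (\<Union>c\<in>nbrs E y - {x}. branch E y c) \<subseteq> branch E x y"
    using branch_start[OF assms] by auto
qed

lemma Union_branchE:
  assumes "z \<in> \<Union>(branch E x y)"
  obtains "z = x" | n a where "dart_path E x y n a z"
proof -
  from assms obtain n a b where n: "dart_path E x y n a b" "z \<in> {a, b}"
    by (auto simp: branch_def)
  show ?thesis
  proof (cases "z = b")
    case False
    with n have [simp]: "z = a" by auto
    from n(1) show ?thesis
      using that by cases auto
  qed (use n that in auto)
qed

context forest
begin

lemma dart_path_neq:
  assumes "dart_path E x y n a b"
  shows "x \<noteq> b"
proof -
  obtain ws vs where w: "nb_walk E (x # y # ws)" "x # y # ws = vs @ [a, b]"
    using dart_path_nb_walk[OF assms] by blast
  have "last (x # y # ws) = b"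
    unfolding w(2) by simp
  then have "b \<in> set (y # ws)"
    using last_in_set[of "y # ws"] by simp
  moreover have "distinct (x # y # ws)"
    using w(1) by (rule nb_walk_distinct)
  ultimately show ?thesis by auto
qed

lemma not_in_Union_branch:
  assumes "{x, y} \<in> E" "c \<noteq> x"
  shows "x \<notin> \<Union>(branch E y c)"
proof
  assume "x \<in> \<Union>(branch E y c)"
  then show False
  proof (cases rule: Union_branchE)
    case 1
    then show False using assms edge_neq by blast
  next
    case (2 n a)
    then have "dart_path E x y (Suc n) a x"
      using assms by (intro dart_path_cons)
    then show False using dart_path_neq by blast
  qed
qed

lemma branch_at_root:
  assumes "e \<in> branch E x y" "x \<in> e"
  shows "e = {x, y}"
proof -
  have "{x, y} \<in> E"
    using assms by (auto simp: branch_def dest: dart_path_edge_start)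
  with assms show ?thesis
    using not_in_Union_branch unfolding branch_unfold[OF \<open>{x, y} \<in> E\<close>] by fastforce
qed

text \<open>
  A common vertex of two branches would close a walk from it through \<open>y\<close> back to itself that never
  turns back.
\<close>

lemma branches_meet:
  assumes "c \<noteq> c'"
  shows "\<Union>(branch E y c) \<inter> \<Union>(branch E y c') \<subseteq> {y}"
proof
  fix z assume z: "z \<in> \<Union>(branch E y c) \<inter> \<Union>(branch E y c')"
  show "z \<in> {y}"
  proof (rule ccontr)
    assume "z \<notin> {y}"
    with z obtain n a m a' where d: "dart_path E y c n a z" "dart_path E y c' m a' z"
    proof -
      have "z \<in> \<Union>(branch E y c)" "z \<in> \<Union>(branch E y c')" "z \<noteq> y"
        using z \<open>z \<notin> {y}\<close> by auto
      then show ?thesis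
        using that Union_branchE[of z E y c] Union_branchE[of z E y c'] by metis
    qed
    have "{c, y} \<in> E"
      using dart_path_edge_start[OF d(1)] by (simp add: insert_commute)
    then have "dart_path E c y (Suc m) a' z"
      using d(2) assms by (intro dart_path_cons) auto
    then have "dart_path E z a (n + Suc m) a' z"
      by (rule dart_path_trans) (rule dart_path_rev[OF d(1)])
    then show False using dart_path_neq by blast
  qed
qed

lemma branches_disjoint:
  assumes "c \<noteq> c'"
  shows "branch E y c \<inter> branch E y c' = {}"
proof (rule ccontr)
  assume "branch E y c \<inter> branch E y c' \<noteq> {}"
  then obtain e where e: "e \<in> branch E y c" "e \<in> branch E y c'" by auto
  then have "e \<subseteq> {y}"
    using branches_meet[OF assms] by blast
  moreover have "card e = 2"
    by (rule card_edge[OF subsetD[OF branch_subset e(1)]])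
  ultimately show False
    using card_mono[of "{y}" e] by simp
qed

end

context forest
begin

text \<open>
  Seen from the far end \<open>z\<close> of a walk, the branches at its start that it does not enter lie ahead.
\<close>

lemma branch_inter_branch:
  assumes "dart_path E y c0 n w z" "c \<in> nbrs E y" "c \<noteq> c0"
  shows "branch E y c \<subseteq> branch E z w"
proof -
  have "dart_path E z w (Suc n) y c"
    using dart_path_rev[OF assms(1)] assms(2,3) by (intro dart_path.step) (auto simp: nbrs_def)
  then show ?thesis by (rule branch_subset_branch)
qed

text \<open>
  The part of a tree between the ends of a walk from the dart \<open>(x, y)\<close> to the dart \<open>(w, z)\<close> is
  \<open>branch E x y \<inter> branch E z w\<close>. It includes all branches leaving the walk at inner vertices, while
  \<open>x\<close> and \<open>z\<close> have degree 1 in it. This lemma is the case of a walk of one edge.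
\<close>

lemma segment_adjacent:
  assumes "{x, y} \<in> E"
  shows "branch E x y \<inter> branch E y x = {{x, y}}"
proof -
  have "branch E y c \<inter> branch E y x = {}" if "c \<in> nbrs E y - {x}" for c
    using that by (intro branches_disjoint) auto
  then have "branch E x y \<inter> branch E y x \<subseteq> {{x, y}}"
    unfolding branch_unfold[OF assms] by blast
  moreover have "{x, y} \<in> branch E x y" "{x, y} \<in> branch E y x"
    using assms branch_start[of x y E] branch_start[of y x E] by (auto simp: insert_commute)
  ultimately show ?thesis by blast
qed

lemma branch_minus_root_edge:
  assumes "{x, y} \<in> E"
  shows "branch E x y - {{x, y}} = (\<Union>c\<in>nbrs E y - {x}. branch E y c)"
proof -
  have "{x, y} \<notin> branch E y c" if "c \<in> nbrs E y - {x}" for c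
    using not_in_Union_branch[OF assms, of c] that by auto
  then show ?thesis
    unfolding branch_unfold[OF assms] by blast
qed

lemma vertex_in_Union_branch: "dart_path E x y n a b \<Longrightarrow> b \<in> \<Union>(branch E x y)"
  by (auto simp: branch_def)

end

section \<open>One vacant vertex in large volumes\<close>

text \<open>
  The function \<open>b\<close> solves the equation that the first-hit
  recursion together with factorisation imposes on a branch in which every vertex but the first has
  \<open>k\<close> neighbours further on.
\<close>

locale rsa_limit = iid_times M E \<tau> + forest E
  for M :: "'w measure" and E :: "'a set set" and \<tau> :: "'a set \<Rightarrow> 'w \<Rightarrow> real" +
  fixes F :: "nat \<Rightarrow> 'a set set" and k :: nat and b :: "real \<Rightarrow> real"
  assumes F_finite: "finite (F j)" and F_subset: "F j \<subseteq> E"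
    and F_eventually: "e \<in> E \<Longrightarrow> \<forall>\<^sub>F j in sequentially. e \<in> F j"
    and b_range: "t \<in> {0..1} \<Longrightarrow> b t \<in> {0..1}"
    and b_integral: "t \<in> {0..1} \<Longrightarrow> ((\<lambda>s. b s ^ k) has_integral 1 - b t) {0..t}"
begin

lemma F_subsetD: "e \<in> F j \<Longrightarrow> e \<in> E"
  using F_subset by blast

lemma vacant_prob_pieces:
  assumes "finite I" "\<And>c. c \<in> I \<Longrightarrow> A c \<subseteq> branch E y c" "y \<in> S" "t \<in> {0..1}"
  shows "vacant_prob (\<Union>c\<in>I. F j \<inter> A c) S t = (\<Prod>c\<in>I. vacant_prob (F j \<inter> A c) S t)"
proof (rule vacant_prob_UN)
  fix c d assume cd: "c \<in> I" "d \<in> I" "c \<noteq> d"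
  show "F j \<inter> A c \<inter> (F j \<inter> A d) = {}"
    using branches_disjoint[OF cd(3), of y] assms(2)[OF cd(1)] assms(2)[OF cd(2)] by blast
  have "\<Union>(F j \<inter> A c) \<inter> \<Union>(F j \<inter> A d) \<subseteq> \<Union>(branch E y c) \<inter> \<Union>(branch E y d)"
    using assms(2)[OF cd(1)] assms(2)[OF cd(2)] by blast
  then show "\<Union>(F j \<inter> A c) \<inter> \<Union>(F j \<inter> A d) \<subseteq> S"
    using branches_meet[OF cd(3), of y] assms(3) by blast
qed (use assms F_finite F_subsetD in auto)

text \<open>
  The first vertex \<open>x\<close> of a branch has one edge there. When it is hit, the branches further on are
  still independent with their common vertex \<open>y\<close> vacant.
\<close>

lemma vacant_prob_root_edge:
  assumes fin: "finite (nbrs E y)" and e: "{x, y} \<in> F j" and t: "t \<in> {0..1}"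
  shows "vacant_prob (F j \<inter> branch E x y) {x} t =
    1 - integral {0..t} (\<lambda>s. \<Prod>c\<in>nbrs E y - {x}. vacant_prob (F j \<inter> branch E y c) {y} s)"
    and "(\<lambda>s. \<Prod>c\<in>nbrs E y - {x}. vacant_prob (F j \<inter> branch E y c) {y} s) integrable_on {0..t}"
proof -
  have E: "{x, y} \<in> E"
    using e F_subset by auto
  let ?G = "F j \<inter> branch E x y" and ?C = "nbrs E y - {x}"
  have fin_G: "finite ?G" "?G \<subseteq> E"
    using F_finite F_subsetD by auto
  have "{x, y} \<in> ?G"
    using e E by (auto intro: branch_start)
  then have roots: "{e. e \<in> ?G \<and> e \<inter> {x} \<noteq> {}} = {{x, y}}"
    using branch_at_root by blast
  have G': "?G - {{x, y}} = (\<Union>c\<in>?C. F j \<inter> branch E y c)"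
    using branch_minus_root_edge[OF E] by blast
  have eq: "vacant_prob (?G - {{x, y}}) ({x} \<union> {x, y}) s =
      (\<Prod>c\<in>?C. vacant_prob (F j \<inter> branch E y c) {y} s)" if s: "s \<in> {0..1}" for s
  proof -
    have "vacant_prob (?G - {{x, y}}) ({x} \<union> {x, y}) s =
        (\<Prod>c\<in>?C. vacant_prob (F j \<inter> branch E y c) ({x} \<union> {x, y}) s)"
      unfolding G' using fin s by (intro vacant_prob_pieces) auto
    also have "\<dots> = (\<Prod>c\<in>?C. vacant_prob (F j \<inter> branch E y c) {y} s)"
    proof (intro prod.cong refl vacant_prob_cong_sites)
      fix c assume "c \<in> ?C"
      then have "x \<notin> \<Union>(branch E y c)"
        by (intro not_in_Union_branch[OF E]) auto
      then show "({x} \<union> {x, y}) \<inter> \<Union>(F j \<inter> branch E y c) = {y} \<inter> \<Union>(F j \<inter> branch E y c)"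
        by blast
    qed (use F_finite F_subsetD in auto)
    finally show ?thesis .
  qed
  have int: "vacant_prob (?G - {{x, y}}) ({x} \<union> {x, y}) integrable_on {0..t}"
    using fin_G t E by (intro vacant_prob_integrable[of "{x, y}"]) auto
  show "(\<lambda>s. \<Prod>c\<in>?C. vacant_prob (F j \<inter> branch E y c) {y} s) integrable_on {0..t}"
    using int by (rule integrable_eq) (use t eq in auto)
  have "integral {0..t} (vacant_prob (?G - {{x, y}}) ({x} \<union> {x, y})) =
      integral {0..t} (\<lambda>s. \<Prod>c\<in>?C. vacant_prob (F j \<inter> branch E y c) {y} s)"
    by (intro integral_cong) (use t eq in auto)
  moreover have "vacant_prob ?G {x} t =
      1 - (\<Sum>e | e \<in> ?G \<and> e \<inter> {x} \<noteq> {}. integral {0..t} (vacant_prob (?G - {e}) ({x} \<union> e)))"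
    using fin_G t by (intro vacant_prob_recursion) auto
  ultimately show "vacant_prob ?G {x} t =
    1 - integral {0..t} (\<lambda>s. \<Prod>c\<in>?C. vacant_prob (F j \<inter> branch E y c) {y} s)"
    unfolding roots by simp
qed

definition regular_from :: "'a \<Rightarrow> 'a \<Rightarrow> bool" where
  "regular_from x y \<longleftrightarrow> (\<forall>m a b. dart_path E x y m a b \<longrightarrow> card (nbrs E b) = k + 1)"

lemma regular_from_step:
  assumes "regular_from x y" "{x, y} \<in> E" "c \<in> nbrs E y - {x}"
  shows "regular_from y c"
  using assms unfolding regular_from_def by (auto intro: dart_path_cons)

lemma regular_from_card:
  assumes "regular_from x y" "{x, y} \<in> E"
  shows "finite (nbrs E y)" "card (nbrs E y - {x}) = k"
proof -
  have "card (nbrs E y) = k + 1"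
    using assms by (auto simp: regular_from_def intro: dart_path.start)
  then show "finite (nbrs E y)"
    by (metis add_is_0 card.infinite one_neq_zero)
  moreover have "x \<in> nbrs E y"
    using assms by (simp add: nbrs_def insert_commute)
  ultimately show "card (nbrs E y - {x}) = k"
    using \<open>card (nbrs E y) = k + 1\<close> by simp
qed

text \<open>
  Picard iteration. The deviation from \<open>b\<close> is at most 1, and one step of the recursion bounds it on a
  branch by the integral of the sum of the deviations on the \<open>k\<close> branches further on. The volume
  has to be large enough to contain the first \<open>n\<close> generations of the branch only.
\<close>

lemma branch_bound:
  assumes "regular_from x y" "{x, y} \<in> E"
  shows "\<forall>\<^sub>F j in sequentially. \<forall>t\<in>{0..1}.
    \<bar>vacant_prob (F j \<inter> branch E x y) {x} t - b t\<bar> \<le> (real k * t) ^ n / fact n"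
  using assms
proof (induction n arbitrary: x y)
  case 0
  have "\<bar>vacant_prob (F j \<inter> branch E x y) {x} t - b t\<bar> \<le> 1" if "t \<in> {0..1}" for t j
  proof -
    have "0 \<le> vacant_prob (F j \<inter> branch E x y) {x} t" "vacant_prob (F j \<inter> branch E x y) {x} t \<le> 1"
      by simp_all
    with b_range[OF that] show ?thesis
      by (simp only: atLeastAtMost_iff abs_le_iff) linarith
  qed
  then show ?case by (intro always_eventually) auto
next
  case (Suc n)
  let ?C = "nbrs E y - {x}"
  note C = regular_from_card[OF Suc.prems]
  have "\<forall>\<^sub>F j in sequentially. \<forall>c\<in>?C. \<forall>t\<in>{0..1}.
      \<bar>vacant_prob (F j \<inter> branch E y c) {y} t - b t\<bar> \<le> (real k * t) ^ n / fact n"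
    using C(1) Suc.prems regular_from_step
    by (intro eventually_ball_finite) (auto intro!: Suc.IH simp: nbrs_def)
  then show ?case
    using F_eventually[OF Suc.prems(2)]
  proof eventually_elim
    case (elim j)
    let ?q = "\<lambda>c. vacant_prob (F j \<inter> branch E y c) {y}"
    let ?P = "\<lambda>s. \<Prod>c\<in>?C. ?q c s"
    show ?case
    proof
      fix t :: real assume t: "t \<in> {0..1}"
      have P: "vacant_prob (F j \<inter> branch E x y) {x} t = 1 - integral {0..t} ?P" "?P integrable_on {0..t}"
        using vacant_prob_root_edge[OF C(1) elim(2) t] by auto
      have B: "(\<lambda>s. b s ^ k) integrable_on {0..t}" "integral {0..t} (\<lambda>s. b s ^ k) = 1 - b t"
        using b_integral[OF t] by (auto simp: has_integral_iff)
      have I: "((\<lambda>s. real k * ((real k * s) ^ n / fact n)) has_integral (real k * t) ^ Suc n / fact (Suc n) - (real k * 0) ^ Suc n / fact (Suc n)) {0..t}"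
      proof (rule fundamental_theorem_of_calculus)
        fix s
        have "((\<lambda>s. (real k * s) ^ Suc n / fact (Suc n)) has_real_derivative
            (real (Suc n) * (real k * s) ^ n * real k) / fact (Suc n)) (at s within {0..t})"
          by (auto intro!: derivative_eq_intros simp del: power_Suc fact_Suc)
        also have "(real (Suc n) * (real k * s) ^ n * real k) / fact (Suc n) = real k * ((real k * s) ^ n / fact n)"
          unfolding fact_Suc by (simp del: of_nat_Suc)
        finally show "((\<lambda>s. (real k * s) ^ Suc n / fact (Suc n)) has_vector_derivative
            real k * ((real k * s) ^ n / fact n)) (at s within {0..t})"
          by (simp only: has_real_derivative_iff_has_vector_derivative)
      qed (use t in auto)
      have diff: "norm (?P s - b s ^ k) \<le> real k * ((real k * s) ^ n / fact n)" if "s \<in> {0..t}" for s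
      proof -
        have s: "s \<in> {0..1}" using that t by auto
        have "norm (?P s - (\<Prod>c\<in>?C. b s)) \<le> (\<Sum>c\<in>?C. norm (?q c s - b s))"
          using b_range[OF s] by (intro norm_prod_diff) auto
        also have "\<dots> \<le> (\<Sum>c\<in>?C. (real k * s) ^ n / fact n)"
          using elim(1) s by (intro sum_mono) auto
        finally show ?thesis
          using C(2) by simp
      qed
      have "vacant_prob (F j \<inter> branch E x y) {x} t - b t = - integral {0..t} (\<lambda>s. ?P s - b s ^ k)"
        using P B by (subst integral_diff) auto
      then have "\<bar>vacant_prob (F j \<inter> branch E x y) {x} t - b t\<bar> = norm (integral {0..t} (\<lambda>s. ?P s - b s ^ k))"
        by simp
      also have "\<dots> \<le> integral {0..t} (\<lambda>s. real k * ((real k * s) ^ n / fact n))"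
        using P(2) B(1) I diff
        by (intro integral_norm_bound_integral integrable_diff) (auto simp: has_integral_iff)
      also have "\<dots> = (real k * t) ^ Suc n / fact (Suc n)"
        using I by (simp add: has_integral_iff)
      finally show "\<bar>vacant_prob (F j \<inter> branch E x y) {x} t - b t\<bar> \<le> (real k * t) ^ Suc n / fact (Suc n)" .
    qed
  qed
qed

lemma branch_tendsto:
  assumes "regular_from x y" "{x, y} \<in> E" and t: "t \<in> {0..1}"
  shows "(\<lambda>j. vacant_prob (F j \<inter> branch E x y) {x} t) \<longlonglongrightarrow> b t"
proof (rule tendstoI)
  fix \<epsilon> :: real assume "\<epsilon> > 0"
  have "(\<lambda>n. (real k * t) ^ n / fact n) \<longlonglongrightarrow> 0"
    using summable_LIMSEQ_zero[OF summable_exp_generic[of "real k * t"]] by (simp add: divide_inverse mult.commute)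
  then have "\<forall>\<^sub>F n in sequentially. (real k * t) ^ n / fact n < \<epsilon>"
    using \<open>\<epsilon> > 0\<close> by (rule order_tendstoD)
  then obtain n where n: "(real k * t) ^ n / fact n < \<epsilon>"
    by (auto simp: eventually_sequentially)
  from branch_bound[OF assms(1,2), of n]
  show "\<forall>\<^sub>F j in sequentially. dist (vacant_prob (F j \<inter> branch E x y) {x} t) (b t) < \<epsilon>"
    by eventually_elim (use n t in \<open>force simp: dist_real_def\<close>)
qed

text \<open>
  Several branches at \<open>y\<close>, all complete except possibly one: in the direction \<open>c0\<close> of the second vacant vertex
  \<open>z\<close> only the part \<open>X\<close> is present. The complete branches contribute a factor \<open>b t\<close> each.
\<close>

lemma star_tendsto:
  assumes I: "finite I" "c0 \<in> I" "I \<subseteq> nbrs E y" and X: "X \<subseteq> branch E y c0"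
    and S: "y \<in> S" "S \<inter> (\<Union>c\<in>I. \<Union>(branch E y c)) \<subseteq> {y, z}" "z \<in> \<Union>(branch E y c0)"
    and L: "(\<lambda>j. vacant_prob (F j \<inter> X) S t) \<longlonglongrightarrow> L"
    and reg: "\<And>c. c \<in> I - {c0} \<Longrightarrow> regular_from y c" and t: "t \<in> {0..1}"
  shows "(\<lambda>j. vacant_prob (\<Union>c\<in>I. F j \<inter> (if c = c0 then X else branch E y c)) S t) \<longlonglongrightarrow> b t ^ (card I - 1) * L"
proof -
  let ?A = "\<lambda>c. if c = c0 then X else branch E y c"
  have eq: "vacant_prob (\<Union>c\<in>I. F j \<inter> ?A c) S t =
      vacant_prob (F j \<inter> X) S t * (\<Prod>c\<in>I - {c0}. vacant_prob (F j \<inter> branch E y c) {y} t)" for j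
  proof -
    have "vacant_prob (\<Union>c\<in>I. F j \<inter> ?A c) S t = (\<Prod>c\<in>I. vacant_prob (F j \<inter> ?A c) S t)"
      using I X S t by (intro vacant_prob_pieces) auto
    also have "\<dots> = vacant_prob (F j \<inter> X) S t * (\<Prod>c\<in>I - {c0}. vacant_prob (F j \<inter> ?A c) S t)"
      using I by (subst prod.remove[of I c0]) auto
    also have "(\<Prod>c\<in>I - {c0}. vacant_prob (F j \<inter> ?A c) S t) = (\<Prod>c\<in>I - {c0}. vacant_prob (F j \<inter> branch E y c) {y} t)"
    proof (intro prod.cong refl)
      fix c assume c: "c \<in> I - {c0}"
      have "S \<inter> \<Union>(branch E y c) \<subseteq> {y}"
        using branches_meet[of c c0 y] c S by blast
      then have "vacant_prob (F j \<inter> branch E y c) S t = vacant_prob (F j \<inter> branch E y c) {y} t"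
        using F_finite F_subsetD S(1) by (intro vacant_prob_cong_sites) auto
      then show "vacant_prob (F j \<inter> ?A c) S t = vacant_prob (F j \<inter> branch E y c) {y} t"
        using c by simp
    qed
    finally show ?thesis .
  qed
  have "(\<lambda>j. \<Prod>c\<in>I - {c0}. vacant_prob (F j \<inter> branch E y c) {y} t) \<longlonglongrightarrow> (\<Prod>c\<in>I - {c0}. b t)"
    using I reg t by (intro tendsto_prod branch_tendsto) (auto simp: nbrs_def)
  from tendsto_mult[OF L this] show ?thesis
    unfolding eq using I by (simp add: mult.commute)
qed

lemma vertex_tendsto:
  assumes "card (nbrs E v) = n" "n > 0" "\<And>c. c \<in> nbrs E v \<Longrightarrow> regular_from v c" and t: "t \<in> {0..1}"
    and cover: "E = (\<Union>c\<in>nbrs E v. branch E v c)"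
  shows "(\<lambda>j. vacant_prob (F j) {v} t) \<longlonglongrightarrow> b t ^ n"
proof -
  have fin: "finite (nbrs E v)"
    using assms card_gt_0_iff by blast
  have "vacant_prob (F j) {v} t = (\<Prod>c\<in>nbrs E v. vacant_prob (F j \<inter> branch E v c) {v} t)" for j
  proof -
    have "F j = (\<Union>c\<in>nbrs E v. F j \<inter> branch E v c)"
      using F_subset[of j] cover by blast
    then show ?thesis
      using vacant_prob_pieces[OF fin, of "branch E v" v "{v}" t j] t by simp
  qed
  moreover have "(\<lambda>j. \<Prod>c\<in>nbrs E v. vacant_prob (F j \<inter> branch E v c) {v} t) \<longlonglongrightarrow> (\<Prod>c\<in>nbrs E v. b t)"
    using assms by (intro tendsto_prod branch_tendsto) (auto simp: nbrs_def)
  ultimately show ?thesis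
    using assms by simp
qed

end

section \<open>Two vacant vertices in large volumes\<close>

text \<open>
  \<open>G n t\<close> is the limiting probability that both ends of a segment with \<open>n + 1\<close> edges on its walk
  are vacant. Its equation says that the first hit uses the edge at one of the two ends (hence the
  factor 2), after which the next inner vertex is the end of a shorter segment and carries \<open>k - 1\<close>
  complete branches.
\<close>

locale rsa_limit_regular = rsa_limit +
  fixes G :: "nat \<Rightarrow> real \<Rightarrow> real"
  assumes regular: "{x, y} \<in> E \<Longrightarrow> card (nbrs E y) = k + 1"
    and G_0: "t \<in> {0..1} \<Longrightarrow> G 0 t = 1 - t"
    and G_Suc: "t \<in> {0..1} \<Longrightarrow> ((\<lambda>s. 2 * (b s ^ (k - 1) * G n s)) has_integral 1 - G (Suc n) t) {0..t}"
begin

lemma regular_from: "regular_from x y"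
  unfolding regular_from_def by (intro allI impI) (rule regular[OF dart_path_edge])

abbreviation seg :: "'b \<Rightarrow> 'b \<Rightarrow> 'b \<Rightarrow> 'b \<Rightarrow> 'b set set" where
  "seg x y w z \<equiv> branch E x y \<inter> branch E z w"

text \<open>
  Removing the first edge of a segment leaves, at \<open>y\<close>, a shorter segment and complete branches.
\<close>

lemma segment_step_tendsto:
  assumes p: "dart_path E x y (Suc n) w z" and t: "t \<in> {0..1}"
    and IH: "\<And>c. dart_path E y c n w z \<Longrightarrow>
      (\<lambda>j. vacant_prob (F j \<inter> seg y c w z) {y, z} t) \<longlonglongrightarrow> G n t"
  shows "(\<lambda>j. vacant_prob (F j \<inter> seg x y w z - {{x, y}}) ({x, z} \<union> {x, y}) t) \<longlonglongrightarrow> b t ^ (k - 1) * G n t"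
proof -
  obtain c0 where c0: "c0 \<noteq> x" "{y, c0} \<in> E" "dart_path E y c0 n w z"
    using p by (rule dart_path_SucE)
  have xy: "{x, y} \<in> E"
    using p by (rule dart_path_edge_start)
  let ?I = "nbrs E y - {x}" and ?S = "{x, z} \<union> {x, y}"
  note I = regular_from_card[OF regular_from xy]
  have c0_in: "c0 \<in> ?I"
    using c0 by (simp add: nbrs_def)
  have x_notin: "x \<notin> \<Union>(branch E y c)" if "c \<in> ?I" for c
    using that by (intro not_in_Union_branch[OF xy]) auto
  have set_eq: "F j \<inter> seg x y w z - {{x, y}} = (\<Union>c\<in>?I. F j \<inter> (if c = c0 then seg y c0 w z else branch E y c))" for j
  proof -
    have "branch E y c \<inter> branch E z w = (if c = c0 then seg y c0 w z else branch E y c)" if "c \<in> ?I" for c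
      using branch_inter_branch[OF c0(3), of c] that by auto
    then have "(\<Union>c\<in>?I. F j \<inter> (if c = c0 then seg y c0 w z else branch E y c)) =
      (\<Union>c\<in>?I. F j \<inter> (branch E y c \<inter> branch E z w))"
      by (intro SUP_cong) auto
    also have "\<dots> = F j \<inter> branch E z w \<inter> (\<Union>c\<in>?I. branch E y c)"
      by blast
    finally show ?thesis
      unfolding branch_minus_root_edge[OF xy, symmetric] by blast
  qed
  have "vacant_prob (F j \<inter> seg y c0 w z) ?S t = vacant_prob (F j \<inter> seg y c0 w z) {y, z} t" for j
    using F_finite F_subsetD x_notin[OF c0_in] by (intro vacant_prob_cong_sites) auto
  then have L: "(\<lambda>j. vacant_prob (F j \<inter> seg y c0 w z) ?S t) \<longlonglongrightarrow> G n t"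
    using IH[OF c0(3)] by simp
  have "(\<lambda>j. vacant_prob (\<Union>c\<in>?I. F j \<inter> (if c = c0 then seg y c0 w z else branch E y c)) ?S t)
      \<longlonglongrightarrow> b t ^ (card ?I - 1) * G n t"
    using I c0_in x_notin t vertex_in_Union_branch[OF c0(3)] regular_from
    by (intro star_tendsto[where z = z] L) auto
  then show ?thesis
    unfolding set_eq I(2) .
qed

text \<open>
  The two end edges of a segment play symmetric roles, because reversing the walk gives the same
  segment; so the preceding lemma covers both terms of the recursion.
\<close>

lemma segment_tendsto:
  assumes "dart_path E x y n w z" "t \<in> {0..1}"
  shows "(\<lambda>j. vacant_prob (F j \<inter> seg x y w z) {x, z} t) \<longlonglongrightarrow> G n t"
  using assms
proof (induction n arbitrary: x y w z t)
  case 0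
  then have [simp]: "w = x" "z = y" and xy: "{x, y} \<in> E"
    by (auto elim: dart_path.cases)
  have "\<forall>\<^sub>F j in sequentially. vacant_prob (F j \<inter> seg x y w z) {x, z} t = 1 - t"
    using F_eventually[OF xy]
  proof eventually_elim
    case (elim j)
    then have "F j \<inter> seg x y w z = {{x, y}}"
      using segment_adjacent[OF xy] by auto
    moreover have "vacant_prob {{x, y}} {x, y} t = 1 - integral {0..t} (\<lambda>s. 1)"
    proof -
      have 1: "{e. e \<in> {{x, y}} \<and> e \<inter> {x, y} \<noteq> {}} = {{x, y}}" by auto
      have "integral {0..t} (vacant_prob {} {x, y}) = integral {0..t} (\<lambda>s. 1)"
        using \<open>t \<in> {0..1}\<close> by (intro integral_cong) auto
      moreover have "vacant_prob {{x, y}} {x, y} t =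
          1 - (\<Sum>e | e \<in> {{x, y}} \<and> e \<inter> {x, y} \<noteq> {}. integral {0..t} (vacant_prob ({{x, y}} - {e}) ({x, y} \<union> e)))"
        using xy \<open>t \<in> {0..1}\<close> by (intro vacant_prob_recursion) auto
      ultimately show ?thesis
        unfolding 1 by simp
    qed
    ultimately show ?case
      using \<open>t \<in> {0..1}\<close> by simp
  qed
  then show ?case
    using 0(2) by (simp add: G_0 tendsto_eventually)
next
  case (Suc n)
  note p = Suc.prems(1) and t = Suc.prems(2)
  have p': "dart_path E z w (Suc n) y x"
    using p by (rule dart_path_rev)
  have xy: "{x, y} \<in> E" and wz: "{w, z} \<in> E"
    using p by (auto intro: dart_path_edge dart_path_edge_start)
  obtain c0 where c0: "dart_path E y c0 n w z"
    using p by (rule dart_path_SucE)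
  have "z \<noteq> x" "z \<noteq> y"
    using dart_path_neq[OF p] dart_path_neq[OF c0] by auto
  then have neq: "{x, y} \<noteq> {w, z}"
    by auto
  then have sum2: "(\<Sum>e\<in>{{x, y}, {w, z}}. f e) = f {x, y} + f {w, z}" for f :: "'b set \<Rightarrow> real"
    by simp
  let ?G = "\<lambda>j. F j \<inter> seg x y w z"
  let ?q1 = "\<lambda>j. vacant_prob (?G j - {{x, y}}) ({x, z} \<union> {x, y})"
  let ?q2 = "\<lambda>j. vacant_prob (?G j - {{w, z}}) ({x, z} \<union> {w, z})"
  have G: "finite (?G j)" "?G j \<subseteq> E" for j
    using F_finite F_subsetD by auto
  have int: "?q1 j integrable_on {0..t}" "?q2 j integrable_on {0..t}" for j
    using G[of j] t xy wz by (intro vacant_prob_integrable[of "{x, y}"] vacant_prob_integrable[of "{w, z}"]; auto)+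
  have ev: "\<forall>\<^sub>F j in sequentially. vacant_prob (?G j) {x, z} t = 1 - integral {0..t} (\<lambda>s. ?q1 j s + ?q2 j s)"
    using F_eventually[OF xy] F_eventually[OF wz]
  proof eventually_elim
    case (elim j)
    have "{x, y} \<in> branch E x y" "{z, w} \<in> branch E z w"
      using branch_start[of x y E] branch_start[of z w E] xy wz by (auto simp: insert_commute)
    moreover have "{x, y} \<in> branch E z w" "{z, w} \<in> branch E x y"
      using p p' unfolding branch_def by (auto simp: insert_commute)
    ultimately have "{x, y} \<in> ?G j" "{w, z} \<in> ?G j"
      using elim by (auto simp: insert_commute)
    then have roots: "{e. e \<in> ?G j \<and> e \<inter> {x, z} \<noteq> {}} = {{x, y}, {w, z}}"
      using branch_at_root[of _ x y] branch_at_root[of _ z w] by (auto simp: insert_commute)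
    have "vacant_prob (?G j) {x, z} t =
        1 - (\<Sum>e | e \<in> ?G j \<and> e \<inter> {x, z} \<noteq> {}. integral {0..t} (vacant_prob (?G j - {e}) ({x, z} \<union> e)))"
      using G[of j] t by (intro vacant_prob_recursion) auto
    then have "vacant_prob (?G j) {x, z} t = 1 - (integral {0..t} (?q1 j) + integral {0..t} (?q2 j))"
      unfolding roots sum2 .
    then show ?case
      using int[of j] by (subst integral_add) auto
  qed
  have lim: "(\<lambda>j. ?q1 j s + ?q2 j s) \<longlonglongrightarrow> 2 * (b s ^ (k - 1) * G n s)" if s: "s \<in> {0..1}" for s
  proof -
    have 1: "(\<lambda>j. ?q1 j s) \<longlonglongrightarrow> b s ^ (k - 1) * G n s"
      using Suc.IH s by (intro segment_step_tendsto[OF p s])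
    have "(\<lambda>j. vacant_prob (F j \<inter> seg z w y x - {{z, w}}) ({z, x} \<union> {z, w}) s) \<longlonglongrightarrow> b s ^ (k - 1) * G n s"
      using Suc.IH s by (intro segment_step_tendsto[OF p' s])
    then have 2: "(\<lambda>j. ?q2 j s) \<longlonglongrightarrow> b s ^ (k - 1) * G n s"
      by (simp add: insert_commute Int_commute)
    show ?thesis
      using tendsto_add[OF 1 2] by (simp only: mult_2)
  qed
  have "(\<lambda>j. integral {0..t} (\<lambda>s. ?q1 j s + ?q2 j s)) \<longlonglongrightarrow> integral {0..t} (\<lambda>s. 2 * (b s ^ (k - 1) * G n s))"
  proof (rule dominated_convergence(2)[where h = "\<lambda>_. 2"])
    show "norm (?q1 j s + ?q2 j s) \<le> 2" for j s
    proof -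
      have "0 \<le> ?q1 j s" "?q1 j s \<le> 1" "0 \<le> ?q2 j s" "?q2 j s \<le> 1"
        by (rule vacant_prob_nonneg vacant_prob_le_1)+
      then show ?thesis by (simp only: real_norm_def abs_le_iff) linarith
    qed
  qed (use int t lim in \<open>auto intro: integrable_add\<close>)
  then have "(\<lambda>j. 1 - integral {0..t} (\<lambda>s. ?q1 j s + ?q2 j s)) \<longlonglongrightarrow> 1 - integral {0..t} (\<lambda>s. 2 * (b s ^ (k - 1) * G n s))"
    by (intro tendsto_intros)
  moreover have "1 - integral {0..t} (\<lambda>s. 2 * (b s ^ (k - 1) * G n s)) = G (Suc n) t"
    using G_Suc[OF t, of n] by (simp add: has_integral_iff)
  ultimately show ?case
    using ev by (simp add: tendsto_cong)
qed

text \<open>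
  A tree splits at \<open>x\<close> and \<open>z\<close> into the segment between them and \<open>k\<close> further branches at each.
\<close>

lemma pair_tendsto:
  assumes p: "dart_path E x y n w z" and t: "t \<in> {0..1}"
    and cover: "\<And>v. v \<in> {x, z} \<Longrightarrow> E = (\<Union>c\<in>nbrs E v. branch E v c)"
  shows "(\<lambda>j. vacant_prob (F j) {x, z} t) \<longlonglongrightarrow> b t ^ (2 * k) * G n t"
proof -
  have xy: "{x, y} \<in> E" and wz: "{z, w} \<in> E"
    using p by (auto intro: dart_path_edge dart_path_edge_start simp: insert_commute)
  have y: "y \<in> nbrs E x" and w: "w \<in> nbrs E z"
    using xy wz by (auto simp: nbrs_def)
  have card: "card (nbrs E x) = k + 1" "card (nbrs E z) = k + 1"
    using regular[of y x] regular[of w z] xy wz by (auto simp: insert_commute)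
  then have fin: "finite (nbrs E x)" "finite (nbrs E z)"
    by (metis add_is_0 card.infinite one_neq_zero)+
  have p': "dart_path E z w n y x"
    using p by (rule dart_path_rev)
  have 1: "(\<lambda>j. vacant_prob (\<Union>c\<in>nbrs E z. F j \<inter> (if c = w then seg x y w z else branch E z c)) {x, z} t)
      \<longlonglongrightarrow> b t ^ (card (nbrs E z) - 1) * G n t"
    using fin w t vertex_in_Union_branch[OF p'] regular_from
    by (intro star_tendsto[where z = x] segment_tendsto[OF p t]) auto
  have eq1: "(\<Union>c\<in>nbrs E z. F j \<inter> (if c = w then seg x y w z else branch E z c)) = F j \<inter> branch E x y" for j
  proof -
    have "branch E z c \<inter> branch E x y = (if c = w then seg x y w z else branch E z c)" if "c \<in> nbrs E z" for c
      using branch_inter_branch[OF p', of c] that by auto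
    then have "(\<Union>c\<in>nbrs E z. F j \<inter> (if c = w then seg x y w z else branch E z c)) =
      (\<Union>c\<in>nbrs E z. F j \<inter> (branch E z c \<inter> branch E x y))"
      by (intro SUP_cong) auto
    also have "\<dots> = F j \<inter> branch E x y \<inter> (\<Union>c\<in>nbrs E z. branch E z c)"
      by blast
    also have "\<dots> = F j \<inter> branch E x y \<inter> E"
      using cover[of z] by simp
    finally show ?thesis
      using F_subset by blast
  qed
  have 2: "(\<lambda>j. vacant_prob (\<Union>c\<in>nbrs E x. F j \<inter> (if c = y then branch E x y else branch E x c)) {x, z} t)
      \<longlonglongrightarrow> b t ^ (card (nbrs E x) - 1) * (b t ^ (card (nbrs E z) - 1) * G n t)"
    using fin y t vertex_in_Union_branch[OF p] regular_from 1[unfolded eq1]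
    by (intro star_tendsto[where z = z]) auto
  have eq2: "(\<Union>c\<in>nbrs E x. F j \<inter> (if c = y then branch E x y else branch E x c)) = F j" for j
  proof -
    have "(\<Union>c\<in>nbrs E x. F j \<inter> (if c = y then branch E x y else branch E x c)) =
        F j \<inter> (\<Union>c\<in>nbrs E x. branch E x c)"
      by (auto split: if_splits)
    also have "\<dots> = F j \<inter> E"
      using cover[of x] by simp
    finally show ?thesis
      using F_subset by blast
  qed
  show ?thesis
    using 2 unfolding eq2 by (simp add: card power_add[symmetric] mult_2 mult.assoc[symmetric])
qed

end

section \<open>Almost sure convergence\<close>

fun chain :: "('e \<Rightarrow> real) \<Rightarrow> real \<Rightarrow> 'e list \<Rightarrow> bool" where
  "chain \<tau> t [] \<longleftrightarrow> True"
| "chain \<tau> t (e # es) \<longleftrightarrow> \<tau> e \<le> t \<and> chain \<tau> (\<tau> e) es"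

text \<open>
  Edge sequences of self-avoiding walks from \<open>x\<close>: a vertex that has been left is deleted, exactly as
  in the recursion \<open>mem_occ_iff_neighbour\<close>.
\<close>

fun paths :: "'a set set \<Rightarrow> nat \<Rightarrow> 'a \<Rightarrow> 'a set list set" where
  "paths E 0 x = {[]}"
| "paths E (Suc n) x = (\<Union>y\<in>nbrs E x. Cons {x, y} ` paths {e \<in> E. x \<notin> e} n y)"

lemma chain_mono: "chain \<tau> s es \<Longrightarrow> s \<le> t \<Longrightarrow> chain \<tau> t es"
  by (cases es) auto

lemma chain_restrict:
  "set es \<subseteq> F \<Longrightarrow> chain (restrict \<tau> F) t es = chain \<tau> t es"
  by (induction es arbitrary: t) auto

lemma sets_chain:
  assumes "\<And>e. e \<in> set es \<Longrightarrow> T e \<in> borel_measurable N" "s \<in> borel_measurable N"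
  shows "{\<omega> \<in> space N. chain (\<lambda>e. T e \<omega>) (s \<omega>) es} \<in> sets N"
  using assms
proof (induction es arbitrary: s)
  case (Cons e es)
  have "{\<omega> \<in> space N. T e \<omega> \<le> s \<omega>} \<in> sets N"
    using Cons.prems by (intro borel_measurable_le) auto
  moreover have "{\<omega> \<in> space N. chain (\<lambda>e. T e \<omega>) (T e \<omega>) es} \<in> sets N"
    using Cons.prems by (intro Cons.IH) auto
  ultimately have "{\<omega> \<in> space N. T e \<omega> \<le> s \<omega>} \<inter> {\<omega> \<in> space N. chain (\<lambda>e. T e \<omega>) (T e \<omega>) es} \<in> sets N"
    by (rule sets.Int)
  also have "{\<omega> \<in> space N. T e \<omega> \<le> s \<omega>} \<inter> {\<omega> \<in> space N. chain (\<lambda>e. T e \<omega>) (T e \<omega>) es} =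
      {\<omega> \<in> space N. chain (\<lambda>e. T e \<omega>) (s \<omega>) (e # es)}"
    by auto
  finally show ?case .
qed simp

lemma nbrs_delete_subset: "nbrs {e \<in> E. x \<notin> e} v \<subseteq> nbrs E v"
  by (auto simp: nbrs_def)

lemma paths_finite_card:
  assumes "\<And>v. finite (nbrs E v)" "\<And>v. card (nbrs E v) \<le> K"
  shows "finite (paths E n x) \<and> card (paths E n x) \<le> K ^ n"
  using assms
proof (induction n arbitrary: E x)
  case (Suc n)
  let ?P = "\<lambda>y. paths {e \<in> E. x \<notin> e} n y"
  have IH: "finite (?P y) \<and> card (?P y) \<le> K ^ n" for y
    by (intro Suc.IH finite_subset[OF nbrs_delete_subset Suc.prems(1)]
        order_trans[OF card_mono[OF Suc.prems(1) nbrs_delete_subset] Suc.prems(2)])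
  have "card (\<Union>y\<in>nbrs E x. Cons {x, y} ` ?P y) \<le> (\<Sum>y\<in>nbrs E x. card (Cons {x, y} ` ?P y))"
    using Suc.prems by (intro card_UN_le)
  also have "\<dots> \<le> (\<Sum>y\<in>nbrs E x. K ^ n)"
    using IH by (intro sum_mono) (meson card_image_le order_trans)
  also have "\<dots> \<le> K ^ Suc n"
    using Suc.prems(2)[of x] by simp
  finally show ?case
    using IH Suc.prems by simp
qed simp

lemma paths_distinct:
  "es \<in> paths E n x \<Longrightarrow> distinct es \<and> set es \<subseteq> E \<and> length es = n"
proof (induction n arbitrary: E x es)
  case (Suc n)
  then obtain y ds where "y \<in> nbrs E x" "es = {x, y} # ds" "ds \<in> paths {e \<in> E. x \<notin> e} n y"
    by auto
  with Suc.IH[OF this(3)] show ?case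
    by (auto simp: nbrs_def)
qed simp

text \<open>
  The state of \<open>x\<close> at time \<open>t\<close> depends on a remote edge only through a walk along which the edge
  times decrease. If no walk of length \<open>n\<close> has this property, the edges within \<open>n\<close> steps decide.
\<close>

lemma occ_insensitive:
  assumes "finite F" "finite F'" "F \<subseteq> E" "F' \<subseteq> E" "inj_on \<tau> E" "\<And>e. e \<in> E \<Longrightarrow> card e = 2"
    and "\<And>es. es \<in> paths E n x \<Longrightarrow> \<not> chain \<tau> t es"
    and "\<And>m es. m \<le> n \<Longrightarrow> es \<in> paths E m x \<Longrightarrow> set es \<subseteq> F \<inter> F'"
  shows "x \<in> occ F \<tau> t \<longleftrightarrow> x \<in> occ F' \<tau> t"
  using assms
proof (induction n arbitrary: E F F' x t)
  case 0
  \<comment> \<open>The empty sequence is always a chain, so the assumption on chains fails.\<close>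
  from 0(7)[of "[]"] show ?case by simp
next
  case (Suc n)
  have inj: "inj_on \<tau> F" "inj_on \<tau> F'"
    using Suc.prems by (auto intro: inj_on_subset)
  have edge: "{x, y} \<in> F \<longleftrightarrow> {x, y} \<in> E" "{x, y} \<in> F' \<longleftrightarrow> {x, y} \<in> E" for y
    using Suc.prems(3,4) Suc.prems(8)[of 1 "[{x, y}]"] by (auto simp: nbrs_def)
  have IH: "y \<in> occ {e \<in> F. x \<notin> e} \<tau> (\<tau> {x, y}) \<longleftrightarrow> y \<in> occ {e \<in> F'. x \<notin> e} \<tau> (\<tau> {x, y})"
    if y: "{x, y} \<in> E" "\<tau> {x, y} \<le> t" for y
  proof (rule Suc.IH[of _ _ "{e \<in> E. x \<notin> e}"])
    show "inj_on \<tau> {e \<in> E. x \<notin> e}"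
      using Suc.prems(5) by (rule inj_on_subset) auto
    show "\<not> chain \<tau> (\<tau> {x, y}) es" if "es \<in> paths {e \<in> E. x \<notin> e} n y" for es
      using Suc.prems(7)[of "{x, y} # es"] that y by (auto simp: nbrs_def)
    show "set es \<subseteq> {e \<in> F. x \<notin> e} \<inter> {e \<in> F'. x \<notin> e}"
      if "m \<le> n" "es \<in> paths {e \<in> E. x \<notin> e} m y" for m es
    proof -
      have "set es \<subseteq> F \<inter> F'"
        using Suc.prems(8)[of "Suc m" "{x, y} # es"] that y by (auto simp: nbrs_def)
      moreover have "set es \<subseteq> {e \<in> E. x \<notin> e}"
        using paths_distinct[OF that(2)] by simp
      ultimately show ?thesis by auto
    qed
  qed (use Suc.prems in auto)
  have "x \<in> occ F \<tau> t \<longleftrightarrow> (\<exists>y. {x, y} \<in> F \<and> \<tau> {x, y} \<le> t \<and> y \<notin> occ {e \<in> F. x \<notin> e} \<tau> (\<tau> {x, y}))"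
    using Suc.prems inj by (intro mem_occ_iff_neighbour) auto
  also have "\<dots> \<longleftrightarrow> (\<exists>y. {x, y} \<in> F' \<and> \<tau> {x, y} \<le> t \<and> y \<notin> occ {e \<in> F'. x \<notin> e} \<tau> (\<tau> {x, y}))"
    unfolding edge using IH by blast
  also have "\<dots> \<longleftrightarrow> x \<in> occ F' \<tau> t"
    using Suc.prems inj by (intro mem_occ_iff_neighbour[symmetric]) auto
  finally show ?case .
qed

lemma has_integral_power_fact:
  assumes "0 \<le> (t :: real)"
  shows "((\<lambda>s. s ^ n / fact n) has_integral t ^ Suc n / fact (Suc n)) {0..t}"
proof -
  have "((\<lambda>s. s ^ n / fact n) has_integral t ^ Suc n / fact (Suc n) - 0 ^ Suc n / fact (Suc n)) {0..t}"
  proof (rule fundamental_theorem_of_calculus)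
    fix s :: real
    have "((\<lambda>s. s ^ Suc n / fact (Suc n)) has_real_derivative (real (Suc n) * s ^ n) / fact (Suc n)) (at s within {0..t})"
      by (auto intro!: derivative_eq_intros simp del: power_Suc fact_Suc)
    also have "(real (Suc n) * s ^ n) / fact (Suc n) = s ^ n / fact n"
      unfolding fact_Suc by (simp del: of_nat_Suc)
    finally show "((\<lambda>s. s ^ Suc n / fact (Suc n)) has_vector_derivative s ^ n / fact n) (at s within {0..t})"
      by (simp only: has_real_derivative_iff_has_vector_derivative)
  qed (use assms in auto)
  then show ?thesis by simp
qed

context iid_times
begin

text \<open>
  Given the first and largest time \<open>s\<close>, the remaining times form a chain below \<open>s\<close>, so the
  probability is an iterated integral of 1.
\<close>

lemma prob_chain:
  assumes "distinct es" "set es \<subseteq> E" "t \<in> {0..1}"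
  shows "prob {\<omega> \<in> space M. chain (\<lambda>e. \<tau> e \<omega>) t es} = t ^ length es / fact (length es)"
  using assms
proof (induction es arbitrary: t)
  case Nil
  then show ?case by (simp add: prob_space)
next
  case (Cons e es)
  let ?F = "set es"
  have "((\<lambda>s. prob {\<omega> \<in> space M. chain (restrict (\<lambda>f. \<tau> f \<omega>) ?F) s es}) has_integral
      prob {\<omega> \<in> space M. \<tau> e \<omega> \<le> t \<and> chain (restrict (\<lambda>f. \<tau> f \<omega>) ?F) (\<tau> e \<omega>) es}) {0..t}"
    using Cons.prems
    by (intro has_integral_condition_edge[where P = "\<lambda>s x. chain x s es"] sets_chain) auto
  then have "((\<lambda>s. prob {\<omega> \<in> space M. chain (\<lambda>f. \<tau> f \<omega>) s es}) has_integral
      prob {\<omega> \<in> space M. chain (\<lambda>f. \<tau> f \<omega>) t (e # es)}) {0..t}"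
    by (simp add: chain_restrict)
  moreover have "((\<lambda>s. prob {\<omega> \<in> space M. chain (\<lambda>f. \<tau> f \<omega>) s es}) has_integral
      t ^ Suc (length es) / fact (Suc (length es))) {0..t}"
  proof (rule has_integral_eq)
    show "((\<lambda>s. s ^ length es / fact (length es)) has_integral t ^ Suc (length es) / fact (Suc (length es))) {0..t}"
      using Cons.prems by (intro has_integral_power_fact) auto
    fix s assume "s \<in> {0..t}"
    then show "s ^ length es / fact (length es) = prob {\<omega> \<in> space M. chain (\<lambda>f. \<tau> f \<omega>) s es}"
      using Cons.prems by (intro Cons.IH[symmetric]) auto
  qed
  ultimately have "prob {\<omega> \<in> space M. chain (\<lambda>f. \<tau> f \<omega>) t (e # es)} = t ^ Suc (length es) / fact (Suc (length es))"
    by (rule has_integral_unique)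
  then show ?case
    by simp
qed

text \<open>
  There are at most \<open>K ^ n\<close> walks of length \<open>n\<close>, and the factorial wins.
\<close>

lemma AE_no_long_chain:
  assumes "\<And>v. finite (nbrs E v)" "\<And>v. card (nbrs E v) \<le> K"
  shows "AE \<omega> in M. \<exists>n. \<forall>es\<in>paths E n x. \<not> chain (\<lambda>e. \<tau> e \<omega>) 1 es"
proof -
  define B where "B n = (\<Union>es\<in>paths E n x. {\<omega> \<in> space M. chain (\<lambda>e. \<tau> e \<omega>) 1 es})" for n
  note P = paths_finite_card[OF assms, of n x for n]
  have chain_ev: "{\<omega> \<in> space M. chain (\<lambda>e. \<tau> e \<omega>) 1 es} \<in> events" if "es \<in> paths E n x" for es n
    using paths_distinct[OF that] by (intro sets_chain rv) auto
  have B[measurable]: "B n \<in> events" for n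
    unfolding B_def using P chain_ev by (intro sets.finite_UN) auto
  have "prob (B n) \<le> real K ^ n / fact n" for n
  proof -
    have "prob (B n) \<le> (\<Sum>es\<in>paths E n x. prob {\<omega> \<in> space M. chain (\<lambda>e. \<tau> e \<omega>) 1 es})"
      unfolding B_def using P chain_ev by (intro finite_measure_subadditive_finite) auto
    also have "\<dots> = (\<Sum>es\<in>paths E n x. 1 / fact n)"
    proof (intro sum.cong refl)
      fix es assume "es \<in> paths E n x"
      from paths_distinct[OF this] show "prob {\<omega> \<in> space M. chain (\<lambda>e. \<tau> e \<omega>) 1 es} = 1 / fact n"
        by (simp add: prob_chain)
    qed
    also have "\<dots> = real (card (paths E n x)) / fact n"
      by simp
    also have "\<dots> \<le> real (K ^ n) / fact n"
      using P by (intro divide_right_mono of_nat_mono) auto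
    finally show ?thesis by simp
  qed
  moreover have "prob (\<Inter>n. B n) \<le> prob (B n)" for n
    by (intro finite_measure_mono) auto
  ultimately have "prob (\<Inter>n. B n) \<le> real K ^ n / fact n" for n
    using order_trans by blast
  moreover have "(\<lambda>n. real K ^ n / fact n) \<longlonglongrightarrow> 0"
    using summable_LIMSEQ_zero[OF summable_exp_generic[of "real K"]] by (simp add: divide_inverse mult.commute)
  ultimately have "prob (\<Inter>n. B n) \<le> 0"
    by (intro LIMSEQ_le_const) auto
  then have "prob (\<Inter>n. B n) = 0"
    using measure_nonneg[of M "\<Inter>n. B n"] by linarith
  then have "AE \<omega> in M. \<omega> \<notin> (\<Inter>n. B n)"
    by (subst (asm) prob_eq_0) auto
  then show ?thesis
    using AE_space by eventually_elim (auto simp: B_def)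
qed

end

text \<open>
  Bounded degrees and an arbitrary exhausting sequence of vertex sets. The process \<open>rsa_rv\<close> is the
  limit along this sequence, with an unspecified value where the limit does not exist.
\<close>

locale rsa_volumes = iid_times M E \<tau>
  for M :: "'w measure" and E :: "'a set set" and \<tau> :: "'a set \<Rightarrow> 'w \<Rightarrow> real" +
  fixes V :: "'a set" and Vs :: "nat \<Rightarrow> 'a set" and K :: nat
  assumes simple: "simple_graph V E" and exh: "exhausting V Vs"
    and nbrs_finite: "finite (nbrs E v)" and nbrs_card: "card (nbrs E v) \<le> K"
begin

definition F :: "nat \<Rightarrow> 'a set set" where
  "F j = {e \<in> E. e \<subseteq> Vs j}"

lemma card_edge: "e \<in> E \<Longrightarrow> card e = 2"
  using simple by (auto simp: simple_graph_def)

lemma F_finite: "finite (F j)"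
proof -
  have "finite (Pow (Vs j))"
    using exh by (auto simp: exhausting_def)
  then show ?thesis
    by (rule rev_finite_subset) (auto simp: F_def)
qed

lemma F_subset: "F j \<subseteq> E"
  by (auto simp: F_def)

lemma F_eventually:
  assumes "e \<in> E"
  shows "\<forall>\<^sub>F j in sequentially. e \<in> F j"
proof -
  have "\<forall>\<^sub>F j in sequentially. v \<in> Vs j" if "v \<in> V" for v
  proof -
    have "v \<in> (\<Union>n. \<Inter>m\<in>{n..}. Vs m)"
      using exh that by (simp add: exhausting_def)
    then show ?thesis
      by (auto simp: eventually_sequentially)
  qed
  moreover have "e \<subseteq> V" "finite e"
    using assms simple card_edge[OF assms] by (auto simp: simple_graph_def intro: card_ge_0_finite)
  ultimately have "\<forall>\<^sub>F j in sequentially. \<forall>v\<in>e. v \<in> Vs j"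
    by (intro eventually_ball_finite) auto
  then show ?thesis
    by eventually_elim (use assms in \<open>auto simp: F_def\<close>)
qed

lemma countable_E: "countable E"
proof -
  have "E \<subseteq> (\<Union>j. F j)"
    using eventually_happens'[OF sequentially_bot F_eventually] by blast
  moreover have "countable (\<Union>j. F j)"
    using F_finite by (intro countable_UN) (auto intro: countable_finite)
  ultimately show ?thesis
    by (rule countable_subset)
qed

abbreviation fin_state :: "real \<Rightarrow> 'a \<Rightarrow> nat \<Rightarrow> 'w \<Rightarrow> real" where
  "fin_state t v j \<omega> \<equiv> rsa_fin E (\<lambda>e. \<tau> e \<omega>) (Vs j) t v"

lemma fin_state_eq: "fin_state t v j \<omega> = (if v \<in> occ (F j) (\<lambda>e. \<tau> e \<omega>) t then 1 else 0)"
  by (simp add: rsa_fin_def occupied_eq_occ F_def)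

lemma fin_state_measurable [measurable]: "fin_state t v j \<in> borel_measurable M"
proof -
  have "{\<omega> \<in> space M. v \<in> occ (F j) (\<lambda>e. \<tau> e \<omega>) t} \<in> events"
    using F_finite F_subset by (rule sets_occ_const)
  then show ?thesis
    unfolding fin_state_eq by (intro measurable_If) auto
qed

lemma rsa_rv_measurable [measurable]: "rsa_rv E \<tau> Vs t v \<in> borel_measurable M"
  unfolding rsa_rv_def[abs_def] rsa_def by measurable

text \<open>
  Once the volume contains all edges that can influence \<open>v\<close>, its state no longer changes.
\<close>

lemma AE_convergence:
  assumes t: "t \<le> 1"
  shows "AE \<omega> in M. (\<lambda>j. fin_state t v j \<omega>) \<longlonglongrightarrow> rsa_rv E \<tau> Vs t v \<omega> \<and> rsa_rv E \<tau> Vs t v \<omega> \<in> {0, 1}"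
  using AE_no_long_chain[OF nbrs_finite nbrs_card, of v] AE_inj_on[OF countable_E order_refl]
proof eventually_elim
  case (elim \<omega>)
  let ?\<tau> = "\<lambda>e. \<tau> e \<omega>"
  obtain n where n: "\<And>es. es \<in> paths E n v \<Longrightarrow> \<not> chain ?\<tau> 1 es"
    using elim(1) by blast
  define B where "B = (\<Union>m\<in>{..n}. \<Union>es\<in>paths E m v. set es)"
  have "finite B"
    unfolding B_def using paths_finite_card[OF nbrs_finite nbrs_card] by auto
  moreover have "B \<subseteq> E"
  proof
    fix e assume "e \<in> B"
    then obtain m es where "es \<in> paths E m v" "e \<in> set es"
      by (auto simp: B_def)
    with paths_distinct[OF this(1)] show "e \<in> E" by auto
  qed
  ultimately have "\<forall>\<^sub>F j in sequentially. \<forall>e\<in>B. e \<in> F j"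
    using F_eventually by (intro eventually_ball_finite) auto
  then obtain N where N: "\<And>j. j \<ge> N \<Longrightarrow> B \<subseteq> F j"
    by (auto simp: eventually_sequentially)
  have eq: "fin_state t v j \<omega> = fin_state t v N \<omega>" if "j \<ge> N" for j
  proof -
    have "v \<in> occ (F j) ?\<tau> t \<longleftrightarrow> v \<in> occ (F N) ?\<tau> t"
    proof (rule occ_insensitive[where n = n])
      show "\<not> chain ?\<tau> t es" if "es \<in> paths E n v" for es
        using n[OF that] chain_mono[OF _ t] by blast
      show "set es \<subseteq> F j \<inter> F N" if "m \<le> n" "es \<in> paths E m v" for m es
        using N[OF \<open>j \<ge> N\<close>] N[OF order_refl] that by (auto simp: B_def)
    qed (use elim(2) in \<open>simp_all add: F_finite F_subset card_edge\<close>)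
    then show ?thesis by (simp add: fin_state_eq)
  qed
  have "(\<lambda>j. fin_state t v j \<omega>) \<longlonglongrightarrow> fin_state t v N \<omega>"
    by (intro tendsto_eventually eventually_sequentiallyI[of N] eq)
  moreover from this have "rsa_rv E \<tau> Vs t v \<omega> = fin_state t v N \<omega>"
    unfolding rsa_rv_def rsa_def by (rule limI)
  ultimately show ?case
    by (simp add: fin_state_eq)
qed

lemma integral_vacant_pair:
  assumes t: "t \<le> 1" and lim: "(\<lambda>j. vacant_prob (F j) {u, w} t) \<longlonglongrightarrow> p"
  shows "(\<integral>\<omega>. (1 - rsa_rv E \<tau> Vs t u \<omega>) * (1 - rsa_rv E \<tau> Vs t w \<omega>) \<partial>M) = p"
proof (rule LIMSEQ_unique[OF _ lim])
  have "(\<lambda>j. \<integral>\<omega>. (1 - fin_state t u j \<omega>) * (1 - fin_state t w j \<omega>) \<partial>M) \<longlonglongrightarrow>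
    (\<integral>\<omega>. (1 - rsa_rv E \<tau> Vs t u \<omega>) * (1 - rsa_rv E \<tau> Vs t w \<omega>) \<partial>M)"
  proof (rule integral_dominated_convergence[where w = "\<lambda>_. 1"])
    show "AE \<omega> in M. (\<lambda>j. (1 - fin_state t u j \<omega>) * (1 - fin_state t w j \<omega>)) \<longlonglongrightarrow>
      (1 - rsa_rv E \<tau> Vs t u \<omega>) * (1 - rsa_rv E \<tau> Vs t w \<omega>)"
      using AE_convergence[OF t, of u] AE_convergence[OF t, of w]
      by eventually_elim (auto intro!: tendsto_intros)
    show "AE \<omega> in M. norm ((1 - fin_state t u j \<omega>) * (1 - fin_state t w j \<omega>)) \<le> 1" for j
      by (simp add: fin_state_eq)
  qed auto
  moreover have "(\<integral>\<omega>. (1 - fin_state t u j \<omega>) * (1 - fin_state t w j \<omega>) \<partial>M) = vacant_prob (F j) {u, w} t" for j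
  proof -
    let ?A = "{\<omega> \<in> space M. {u, w} \<inter> occ (F j) (\<lambda>e. \<tau> e \<omega>) t = {}}"
    have "(\<integral>\<omega>. (1 - fin_state t u j \<omega>) * (1 - fin_state t w j \<omega>) \<partial>M) = (\<integral>\<omega>. indicator ?A \<omega> \<partial>M)"
      by (intro Bochner_Integration.integral_cong refl) (auto simp: fin_state_eq indicator_def)
    moreover have "?A \<in> events"
      using F_finite F_subset by (rule sets_occ_const)
    ultimately show ?thesis
      by (simp add: vacant_prob_def)
  qed
  ultimately show "(\<lambda>j. vacant_prob (F j) {u, w} t) \<longlonglongrightarrow>
    (\<integral>\<omega>. (1 - rsa_rv E \<tau> Vs t u \<omega>) * (1 - rsa_rv E \<tau> Vs t w \<omega>) \<partial>M)"
    by simp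
qed

lemma integral_vacant:
  assumes "t \<le> 1" "(\<lambda>j. vacant_prob (F j) {v} t) \<longlonglongrightarrow> p"
  shows "(\<integral>\<omega>. 1 - rsa_rv E \<tau> Vs t v \<omega> \<partial>M) = p"
proof -
  have "AE \<omega> in M. 1 - rsa_rv E \<tau> Vs t v \<omega> = (1 - rsa_rv E \<tau> Vs t v \<omega>) * (1 - rsa_rv E \<tau> Vs t v \<omega>)"
    using AE_convergence[OF assms(1), of v] by eventually_elim auto
  then have "(\<integral>\<omega>. 1 - rsa_rv E \<tau> Vs t v \<omega> \<partial>M) = (\<integral>\<omega>. (1 - rsa_rv E \<tau> Vs t v \<omega>) * (1 - rsa_rv E \<tau> Vs t v \<omega>) \<partial>M)"
    by (intro integral_cong_AE) auto
  also have "\<dots> = p"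
    using assms by (intro integral_vacant_pair) auto
  finally show ?thesis .
qed

lemma prob_vacant:
  assumes "t \<le> 1" "(\<lambda>j. vacant_prob (F j) {v} t) \<longlonglongrightarrow> p"
  shows "prob {\<omega> \<in> space M. rsa_rv E \<tau> Vs t v \<omega> = 0} = p"
proof -
  let ?A = "{\<omega> \<in> space M. rsa_rv E \<tau> Vs t v \<omega> = 0}"
  have "AE \<omega> in M. 1 - rsa_rv E \<tau> Vs t v \<omega> = indicator ?A \<omega>"
    using AE_convergence[OF assms(1), of v] AE_space by eventually_elim auto
  then have "(\<integral>\<omega>. 1 - rsa_rv E \<tau> Vs t v \<omega> \<partial>M) = (\<integral>\<omega>. indicator ?A \<omega> \<partial>M)"
    by (intro integral_cong_AE) auto
  then show ?thesis
    using integral_vacant[OF assms] by simp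
qed

lemma covariance_eq:
  assumes t: "t \<le> 1"
    and u: "(\<lambda>j. vacant_prob (F j) {u} t) \<longlonglongrightarrow> a" and w: "(\<lambda>j. vacant_prob (F j) {w} t) \<longlonglongrightarrow> a"
    and uw: "(\<lambda>j. vacant_prob (F j) {u, w} t) \<longlonglongrightarrow> p"
  shows "covariance M (rsa_rv E \<tau> Vs t u) (rsa_rv E \<tau> Vs t w) = p - a\<^sup>2"
proof -
  let ?X = "rsa_rv E \<tau> Vs t u" and ?Y = "rsa_rv E \<tau> Vs t w"
  have int1: "integrable M (\<lambda>\<omega>. 1 - rsa_rv E \<tau> Vs t v \<omega>)" for v
  proof (rule integrable_const_bound[where B = 1])
    show "AE \<omega> in M. norm (1 - rsa_rv E \<tau> Vs t v \<omega>) \<le> 1"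
      using AE_convergence[OF t, of v] by eventually_elim auto
  qed auto
  have int2: "integrable M (\<lambda>\<omega>. (1 - ?X \<omega>) * (1 - ?Y \<omega>))"
  proof (rule integrable_const_bound[where B = 1])
    show "AE \<omega> in M. norm ((1 - ?X \<omega>) * (1 - ?Y \<omega>)) \<le> 1"
      using AE_convergence[OF t, of u] AE_convergence[OF t, of w] by eventually_elim auto
  qed auto
  have mean: "(\<integral>\<omega>. rsa_rv E \<tau> Vs t v \<omega> \<partial>M) = 1 - a" if "(\<lambda>j. vacant_prob (F j) {v} t) \<longlonglongrightarrow> a" for v
  proof -
    have "(\<integral>\<omega>. rsa_rv E \<tau> Vs t v \<omega> \<partial>M) = (\<integral>\<omega>. 1 - (1 - rsa_rv E \<tau> Vs t v \<omega>) \<partial>M)"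
      by simp
    also have "\<dots> = 1 - (\<integral>\<omega>. 1 - rsa_rv E \<tau> Vs t v \<omega> \<partial>M)"
      using int1[of v] by (subst Bochner_Integration.integral_diff) (auto simp: prob_space)
    finally show ?thesis
      using integral_vacant[OF t that] by simp
  qed
  have "covariance M ?X ?Y = (\<integral>\<omega>. (1 - ?X \<omega>) * (1 - ?Y \<omega>) - a * (1 - ?X \<omega>) - a * (1 - ?Y \<omega>) + a\<^sup>2 \<partial>M)"
    unfolding covariance_def mean[OF u] mean[OF w]
    by (intro Bochner_Integration.integral_cong refl) (simp add: algebra_simps power2_eq_square)
  also have "\<dots> = (\<integral>\<omega>. (1 - ?X \<omega>) * (1 - ?Y \<omega>) \<partial>M) - a * (\<integral>\<omega>. 1 - ?X \<omega> \<partial>M) - a * (\<integral>\<omega>. 1 - ?Y \<omega> \<partial>M) + a\<^sup>2"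
    using int1[of u] int1[of w] int2 by (simp add: prob_space)
  also have "\<dots> = p - a\<^sup>2"
    unfolding integral_vacant_pair[OF t uw] integral_vacant[OF t u] integral_vacant[OF t w]
    by (simp add: power2_eq_square)
  finally show ?thesis .
qed

end

section \<open>Walks and distances in trees\<close>

lemma degree_eq_card_nbrs:
  assumes "\<And>e. e \<in> E \<Longrightarrow> card e = 2"
  shows "degree E v = card (nbrs E v)"
proof -
  have "bij_betw (\<lambda>c. {v, c}) (nbrs E v) {e \<in> E. v \<in> e}"
    unfolding bij_betw_def
  proof
    show "inj_on (\<lambda>c. {v, c}) (nbrs E v)"
      by (auto simp: inj_on_def doubleton_eq_iff)
    show "(\<lambda>c. {v, c}) ` nbrs E v = {e \<in> E. v \<in> e}"
    proof (intro equalityI subsetI)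
      fix e assume e: "e \<in> {e \<in> E. v \<in> e}"
      then obtain c where "e = {v, c}"
        using assms[of e] by (auto simp: card_2_iff)
      then show "e \<in> (\<lambda>c. {v, c}) ` nbrs E v"
        using e by (auto simp: nbrs_def)
    qed (auto simp: nbrs_def)
  qed
  then show ?thesis
    unfolding degree_def by (metis bij_betw_same_card)
qed

text \<open>
  Cutting out the backtracking of a walk does not make it longer. Appending a step to a
  non-backtracking walk either extends it or undoes its last step.
\<close>

lemma walk_imp_dart_path:
  assumes "walk E xs" "hd xs = u" "last xs = w" "u \<noteq> w"
  shows "\<exists>m y a. Suc m < length xs \<and> dart_path E u y m a w"
  using assms
proof (induction xs arbitrary: w rule: rev_induct)
  case (snoc w' xs)
  then have [simp]: "w' = w" by simp
  have "xs \<noteq> []"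
    using snoc.prems by (cases xs) auto
  then have xs: "walk E xs" "hd xs = u" "{last xs, w} \<in> E"
    using snoc.prems by (auto simp: walk_def successively_append_iff)
  show ?case
  proof (cases "last xs = u")
    case True
    then have "dart_path E u w 0 u w"
      using xs by (auto intro: dart_path.start)
    moreover have "Suc 0 < length (xs @ [w'])"
      using \<open>xs \<noteq> []\<close> by simp
    ultimately show ?thesis by blast
  next
    case False
    then obtain m y a where m: "Suc m < length xs" "dart_path E u y m a (last xs)"
      using snoc.IH[OF xs(1,2) refl] by blast
    show ?thesis
    proof (cases "w = a")
      case True
      from m(2) obtain m' c where "dart_path E u y m' c w" "m = Suc m'"
        using True \<open>u \<noteq> w\<close> by cases auto
      moreover have "Suc m' < length (xs @ [w'])"
        using m calculation by simp
      ultimately show ?thesis by blast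
    next
      case False
      then have "dart_path E u y (Suc m) (last xs) w"
        using m(2) xs(3) by (intro dart_path.step)
      then show ?thesis
        using m(1) by (metis Suc_less_eq length_append_singleton)
    qed
  qed
qed (simp add: walk_def)

lemma dart_path_imp_walk:
  assumes "dart_path E x y n a b"
  shows "\<exists>xs. walk E xs \<and> hd xs = x \<and> last xs = b \<and> length xs = Suc (Suc n)"
  using assms
proof (induction rule: dart_path.induct)
  case start
  then show ?case by (intro exI[of _ "[x, y]"]) (auto simp: walk_def)
next
  case (step n a b c)
  then obtain xs where "walk E xs" "hd xs = x" "last xs = b" "length xs = Suc (Suc n)" by blast
  then show ?case
    using step by (intro exI[of _ "xs @ [c]"]) (auto simp: walk_def successively_append_iff)
qed

lemma graph_dist_dart_path:
  assumes "connected_graph V E" "u \<in> V" "w \<in> V" "graph_dist E u w = Suc n"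
  shows "\<exists>y a. dart_path E u y n a w"
proof -
  let ?P = "\<lambda>n. \<exists>xs. walk E xs \<and> hd xs = u \<and> last xs = w \<and> length xs = Suc n"
  obtain xs where xs: "walk E xs" "hd xs = u" "last xs = w"
    using assms unfolding connected_graph_def by blast
  then have "?P (length xs - 1)"
    by (intro exI[of _ xs]) (auto simp: walk_def)
  then have "?P (graph_dist E u w)"
    unfolding graph_dist_def by (rule LeastI)
  then obtain ys where ys: "walk E ys" "hd ys = u" "last ys = w" "length ys = Suc (Suc n)"
    using assms(4) by auto
  have "u \<noteq> w"
  proof
    assume "u = w"
    then have "?P 0"
      by (intro exI[of _ "[u]"]) (auto simp: walk_def)
    then have "graph_dist E u w \<le> 0"
      unfolding graph_dist_def by (rule Least_le)
    then show False using assms by simp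
  qed
  with walk_imp_dart_path[OF ys(1-3)] ys(4) obtain m y a where m: "m \<le> n" "dart_path E u y m a w"
    by (auto simp: less_Suc_eq_le)
  have "?P (Suc m)"
    using dart_path_imp_walk[OF m(2)] .
  then have "graph_dist E u w \<le> Suc m"
    unfolding graph_dist_def by (rule Least_le)
  then show ?thesis
    using m assms(4) by (cases "m = n") auto
qed

text \<open>
  Connectedness: a walk reaching one end of an edge either extends over the edge or has just crossed
  it.
\<close>

lemma branches_cover:
  assumes "simple_graph V E" "connected_graph V E" "v \<in> V"
  shows "E = (\<Union>c\<in>nbrs E v. branch E v c)"
proof
  show "(\<Union>c\<in>nbrs E v. branch E v c) \<subseteq> E"
    using branch_subset by fastforce
  show "E \<subseteq> (\<Union>c\<in>nbrs E v. branch E v c)"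
  proof
    fix e assume e: "e \<in> E"
    then obtain a b where ab: "e = {a, b}" "a \<in> V" "b \<in> V"
      using assms(1) by (auto simp: simple_graph_def card_2_iff)
    show "e \<in> (\<Union>c\<in>nbrs E v. branch E v c)"
    proof (cases "a = v")
      case True
      then show ?thesis
        using e ab branch_start[of v b E] by (auto simp: nbrs_def)
    next
      case False
      obtain xs where "walk E xs" "hd xs = v" "last xs = a"
        using assms ab unfolding connected_graph_def by blast
      then obtain m y c where m: "dart_path E v y m c a"
        using walk_imp_dart_path[of E xs v a] False by auto
      have "{a, b} \<in> branch E v y"
      proof (cases "b = c")
        case True
        then show ?thesis
          using m by (auto simp: branch_def insert_commute)
      next
        case False
        then have "dart_path E v y (Suc m) a b"
          using m e ab by (intro dart_path.step) auto
        then show ?thesis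
          by (auto simp: branch_def)
      qed
      moreover have "y \<in> nbrs E v"
        using dart_path_edge_start[OF m] by (simp add: nbrs_def)
      ultimately show ?thesis
        using ab by auto
    qed
  qed
qed

section \<open>Closed forms\<close>

lemma has_integral_neg_derivative:
  fixes f g :: "real \<Rightarrow> real"
  assumes "t \<in> {0..1}" "\<And>s. s \<in> {0..1} \<Longrightarrow> (f has_real_derivative - g s) (at s)"
  shows "(g has_integral f 0 - f t) {0..t}"
proof -
  have "((\<lambda>s. - g s) has_integral f t - f 0) {0..t}"
  proof (rule fundamental_theorem_of_calculus)
    fix s assume "s \<in> {0..t}"
    then have "s \<in> {0..1}"
      using assms(1) by simp
    from has_field_derivative_at_within[OF assms(2)[OF this]]
    have "(f has_real_derivative - g s) (at s within {0..t})" .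
    then show "(f has_vector_derivative - g s) (at s within {0..t})"
      by (simp only: has_real_derivative_iff_has_vector_derivative)
  qed (use assms(1) in auto)
  from has_integral_neg[OF this] show ?thesis by simp
qed

definition exp_partial :: "nat \<Rightarrow> real \<Rightarrow> real" where
  "exp_partial n x = (\<Sum>j<n. x ^ j / fact j)"

lemma exp_partial_0 [simp]: "exp_partial 0 x = 0" "exp_partial (Suc n) 0 = 1"
proof -
  have "(\<Sum>j<Suc n. (0::real) ^ j / fact j) = 1"
    by (subst sum.lessThan_Suc_shift) simp
  then show "exp_partial (Suc n) 0 = 1"
    by (simp only: exp_partial_def)
qed (simp add: exp_partial_def)

lemma has_derivative_power_fact:
  "((\<lambda>x. x ^ Suc n / fact (Suc n)) has_real_derivative x ^ n / fact n) (at x)"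
proof -
  have "((\<lambda>x. x ^ Suc n / fact (Suc n)) has_real_derivative (real (Suc n) * x ^ n) / fact (Suc n)) (at x)"
    by (auto intro!: derivative_eq_intros simp del: power_Suc fact_Suc)
  also have "(real (Suc n) * x ^ n) / fact (Suc n) = x ^ n / fact n"
    unfolding fact_Suc by (simp del: of_nat_Suc)
  finally show ?thesis .
qed

lemma has_derivative_exp_partial:
  "(exp_partial (Suc n) has_real_derivative exp_partial n x) (at x)"
proof (induction n)
  case 0
  then show ?case by (simp add: exp_partial_def)
next
  case (Suc n)
  have "((\<lambda>x. exp_partial (Suc n) x + x ^ Suc n / fact (Suc n)) has_real_derivative
      exp_partial n x + x ^ n / fact n) (at x)"
    using Suc has_derivative_power_fact by (rule DERIV_add)
  then show ?case
    by (simp add: exp_partial_def)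
qed

lemma exp_tail: "(\<Sum>i. x ^ (i + n) / fact (i + n)) = exp x - exp_partial n x"
  and summable_exp_tail: "summable (\<lambda>i. x ^ (i + n) / fact (i + n))"
proof -
  have s: "(\<lambda>j. x ^ j / fact j) sums exp x"
    using exp_converges[of x] by (simp add: divide_inverse mult.commute)
  then show "summable (\<lambda>i. x ^ (i + n) / fact (i + n))"
    by (intro summable_ignore_initial_segment) (rule sums_summable)
  show "(\<Sum>i. x ^ (i + n) / fact (i + n)) = exp x - exp_partial n x"
    using suminf_minus_initial_segment[OF sums_summable[OF s], of n] sums_unique[OF s]
    by (simp add: exp_partial_def)
qed

text \<open>
  For \<open>k \<ge> 2\<close>, the equation for \<open>G n\<close> becomes \<open>dG\<^sub>n\<^sub>+\<^sub>1/dx = 2 G\<^sub>n\<close> in the variable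
  \<open>x = ln (b t)\<close>, since \<open>dx/dt = - b t ^ (k - 1)\<close>. This is its solution with
  \<open>G\<^sub>n\<^sub>+\<^sub>1 = 1\<close> at \<open>x = 0\<close> and \<open>G\<^sub>0 = 1 - t\<close>.
\<close>

definition pair_poly :: "nat \<Rightarrow> nat \<Rightarrow> real \<Rightarrow> real" where
  "pair_poly k n x = real k * ((2 * x) ^ n / fact n) / (real k - 1) + exp_partial n (2 * x)
     + 1 / 2 * (2 / (1 - real k)) ^ Suc n * (exp ((1 - real k) * x) - exp_partial n ((1 - real k) * x))"

lemma has_derivative_pair_poly:
  assumes "k \<ge> 2"
  shows "(pair_poly k (Suc n) has_real_derivative 2 * pair_poly k n x) (at x)"
proof -
  let ?c = "1 - real k"
  have c: "?c \<noteq> 0" using assms by simp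
  have lin: "((\<lambda>x. d * x) has_real_derivative d) (at x)" for d :: real
    by (auto intro!: derivative_eq_intros)
  have "(pair_poly k (Suc n) has_real_derivative
      real k * ((2 * x) ^ n / fact n * 2) / (real k - 1) + exp_partial n (2 * x) * 2
      + 1 / 2 * (2 / ?c) ^ Suc (Suc n) * (exp (?c * x) * ?c - exp_partial n (?c * x) * ?c)) (at x)"
    unfolding pair_poly_def[abs_def]
    by (intro DERIV_add DERIV_cmult DERIV_cdivide DERIV_diff DERIV_chain2[OF has_derivative_power_fact lin]
        DERIV_chain2[OF has_derivative_exp_partial lin] DERIV_chain2[OF DERIV_exp lin])
  moreover have "1 / 2 * (2 / ?c) ^ Suc (Suc n) * (exp (?c * x) * ?c - exp_partial n (?c * x) * ?c) =
      2 * (1 / 2 * (2 / ?c) ^ Suc n * (exp (?c * x) - exp_partial n (?c * x)))"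
  proof -
    have "(2 / ?c) ^ Suc (Suc n) * ?c = 2 * (2 / ?c) ^ Suc n"
      using c by simp
    then show ?thesis by (simp only: left_diff_distrib[symmetric]) (simp add: mult.assoc mult.left_commute)
  qed
  ultimately show ?thesis
    by (simp only: pair_poly_def distrib_left) (simp add: mult_ac)
qed

lemma pair_poly_Suc_0 [simp]: "pair_poly k (Suc n) 0 = 1"
  by (simp add: pair_poly_def)

text \<open>
  The logarithm of the vacancy probability of the vertex of degree 1. Its equation
  \<open>L' = - exp L ^ (k - 1)\<close> is uniform in \<open>k\<close>, only its solution takes a different form for \<open>k = 1\<close>.
\<close>

definition log_vac :: "nat \<Rightarrow> real \<Rightarrow> real" where
  "log_vac k t = (if k = 1 then - t else - ln (1 + (real k - 1) * t) / (real k - 1))"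

lemma log_vac_0 [simp]: "log_vac k 0 = 0"
  by (simp add: log_vac_def)

lemma exp_log_vac:
  assumes "k \<ge> 1" "t \<ge> 0"
  shows "exp ((1 - real k) * log_vac k t) = 1 + (real k - 1) * t"
proof (cases "k = 1")
  case False
  then have "real k - 1 > 0" using assms by simp
  then have "1 + (real k - 1) * t > 0"
    using assms by (intro add_pos_nonneg) auto
  moreover have "(1 - real k) * log_vac k t = ln (1 + (real k - 1) * t)"
    using \<open>real k - 1 > 0\<close> False by (simp add: log_vac_def field_simps)
  ultimately show ?thesis by simp
qed simp

lemma has_derivative_log_vac:
  assumes "k \<ge> 1" "t \<ge> 0"
  shows "(log_vac k has_real_derivative - (exp (log_vac k t) ^ (k - 1))) (at t)"
proof (cases "k = 1")
  case True
  then show ?thesis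
    unfolding log_vac_def[abs_def] by (auto intro!: derivative_eq_intros)
next
  case False
  then have c: "real k - 1 > 0" using assms by simp
  then have pos: "1 + (real k - 1) * t > 0"
    using assms by (intro add_pos_nonneg) auto
  have "exp (log_vac k t) ^ (k - 1) = exp (- ((1 - real k) * log_vac k t))"
    using assms by (simp add: exp_of_nat_mult[symmetric] of_nat_diff algebra_simps)
  also have "\<dots> = 1 / (1 + (real k - 1) * t)"
    using exp_log_vac[OF assms] by (simp add: exp_minus inverse_eq_divide)
  finally have eq: "exp (log_vac k t) ^ (k - 1) = 1 / (1 + (real k - 1) * t)" .
  have "((\<lambda>t. - ln (1 + (real k - 1) * t) / (real k - 1)) has_real_derivative - (1 / (1 + (real k - 1) * t))) (at t)"
  proof -
    have "((\<lambda>t. - ln (1 + d * t) / d) has_real_derivative - (1 / (1 + d * t))) (at t)"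
      if "d > 0" "1 + d * t > 0" for d
      using that by (auto intro!: derivative_eq_intros)
    then show ?thesis using c pos by blast
  qed
  then show ?thesis
    using False unfolding log_vac_def[abs_def] eq[unfolded log_vac_def] by simp
qed

lemma log_vac_nonpos: "k \<ge> 1 \<Longrightarrow> t \<ge> 0 \<Longrightarrow> log_vac k t \<le> 0"
  by (auto simp: log_vac_def divide_nonneg_nonneg)

text \<open>
  The solution \<open>G n\<close> as a function of time. For \<open>k = 1\<close> the equation is
  \<open>G\<^sub>n\<^sub>+\<^sub>1' = - 2 G\<^sub>n\<close> directly in \<open>t\<close>, and \<open>G\<^sub>0 = 1 - t\<close> is the first term of the series of
  \<open>exp (- 2 t)\<close> plus half of the second.
\<close>

definition pair_vac :: "nat \<Rightarrow> nat \<Rightarrow> real \<Rightarrow> real" where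
  "pair_vac k n t = (if k = 1 then exp_partial (Suc n) (- 2 * t) + 1 / 2 * ((- 2 * t) ^ Suc n / fact (Suc n))
     else pair_poly k n (log_vac k t))"

lemma pair_vac_0:
  assumes "k \<ge> 1" "t \<ge> 0"
  shows "pair_vac k 0 t = 1 - t"
proof (cases "k = 1")
  case True
  then show ?thesis by (simp add: pair_vac_def exp_partial_def)
next
  case False
  define r where "r = real k - 1"
  have "r > 0" using assms False by (simp add: r_def)
  have k: "real k = r + 1" "1 - real k = - r" by (auto simp: r_def)
  have "pair_vac k 0 t = real k / (real k - 1) + 1 / (1 - real k) * exp ((1 - real k) * log_vac k t)"
    using False by (simp add: pair_vac_def pair_poly_def)
  also have "\<dots> = (r + 1) / r - (1 + r * t) / r"
    unfolding exp_log_vac[OF assms] by (simp only: k) (simp add: diff_divide_distrib)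
  also have "\<dots> = 1 - t"
    using \<open>r > 0\<close> by (simp add: field_simps)
  finally show ?thesis .
qed

lemma pair_vac_integral:
  assumes k: "k \<ge> 1" and t: "t \<in> {0..1}"
  shows "((\<lambda>s. 2 * (exp (log_vac k s) ^ (k - 1) * pair_vac k n s)) has_integral 1 - pair_vac k (Suc n) t) {0..t}"
proof -
  have deriv: "(pair_vac k (Suc n) has_real_derivative - (2 * (exp (log_vac k s) ^ (k - 1) * pair_vac k n s))) (at s)"
    if s: "s \<in> {0..1}" for s
  proof (cases "k = 1")
    case True
    have lin: "((\<lambda>s. - 2 * s) has_real_derivative - 2) (at s)"
      by (auto intro!: derivative_eq_intros)
    have "((\<lambda>s. exp_partial (Suc (Suc n)) (- 2 * s) + 1 / 2 * ((- 2 * s) ^ Suc (Suc n) / fact (Suc (Suc n))))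
        has_real_derivative exp_partial (Suc n) (- 2 * s) * - 2 + 1 / 2 * ((- 2 * s) ^ Suc n / fact (Suc n) * - 2)) (at s)"
      by (intro DERIV_add DERIV_cmult DERIV_chain2[OF has_derivative_power_fact lin]
        DERIV_chain2[OF has_derivative_exp_partial lin])
    also have "exp_partial (Suc n) (- 2 * s) * - 2 + 1 / 2 * ((- 2 * s) ^ Suc n / fact (Suc n) * - 2) =
        - (2 * (exp (log_vac k s) ^ (k - 1) * pair_vac k n s))"
    proof -
      have "pair_vac k n s = exp_partial (Suc n) (- 2 * s) + 1 / 2 * ((- 2 * s) ^ Suc n / fact (Suc n))"
        unfolding pair_vac_def True by (rule if_P) (rule refl)
      moreover have "exp (log_vac k s) ^ (k - 1) = 1"
        by (simp add: True)
      moreover have "a * - 2 + 1 / 2 * (b * - 2) = - (2 * (1 * (a + 1 / 2 * b)))" for a b :: real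
        by simp
      ultimately show ?thesis by (simp only:)
    qed
    also have "(\<lambda>s. exp_partial (Suc (Suc n)) (- 2 * s) + 1 / 2 * ((- 2 * s) ^ Suc (Suc n) / fact (Suc (Suc n)))) =
        pair_vac k (Suc n)"
      by (rule ext) (simp only: pair_vac_def if_P[OF True])
    finally show ?thesis .
  next
    case False
    with k have "k \<ge> 2" by simp
    have "((\<lambda>s. pair_poly k (Suc n) (log_vac k s)) has_real_derivative
        2 * pair_poly k n (log_vac k s) * - (exp (log_vac k s) ^ (k - 1))) (at s)"
      using s k \<open>k \<ge> 2\<close> by (intro DERIV_chain2[OF has_derivative_pair_poly has_derivative_log_vac]) auto
    then show ?thesis
      unfolding pair_vac_def[abs_def] using False by (simp add: mult_ac)
  qed
  have "pair_vac k (Suc n) 0 = 1"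
    by (simp add: pair_vac_def)
  with has_integral_neg_derivative[OF t deriv] show ?thesis
    by (simp only:)
qed

lemma vac_integral:
  assumes k: "k \<ge> 1" and t: "t \<in> {0..1}"
  shows "((\<lambda>s. exp (log_vac k s) ^ k) has_integral 1 - exp (log_vac k t)) {0..t}"
proof -
  have "((\<lambda>s. exp (log_vac k s)) has_real_derivative - (exp (log_vac k s) ^ k)) (at s)" if "s \<in> {0..1}" for s
  proof -
    have "((\<lambda>s. exp (log_vac k s)) has_real_derivative exp (log_vac k s) * - (exp (log_vac k s) ^ (k - 1))) (at s)"
      using that k by (intro DERIV_chain2[OF DERIV_exp has_derivative_log_vac]) auto
    also have "exp (log_vac k s) * - (exp (log_vac k s) ^ (k - 1)) = - (exp (log_vac k s) ^ k)"
      using k by (cases k) auto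
    finally show ?thesis .
  qed
  from has_integral_neg_derivative[OF t this] show ?thesis by simp
qed

section \<open>Vacancy and covariance on the trees\<close>

lemma is_T_nbrs:
  assumes "is_T k V E"
  shows "v \<in> V \<Longrightarrow> card (nbrs E v) = k + 1" "v \<notin> V \<Longrightarrow> nbrs E v = {}" "finite (nbrs E v)" "card (nbrs E v) \<le> k + 1"
proof -
  have simple: "\<And>e. e \<in> E \<Longrightarrow> card e = 2 \<and> e \<subseteq> V"
    using assms by (auto simp: is_T_def infinite_tree_def simple_graph_def)
  then have deg: "degree E v = card (nbrs E v)"
    by (intro degree_eq_card_nbrs) auto
  show 1: "card (nbrs E v) = k + 1" if "v \<in> V"
    using assms deg that by (simp add: is_T_def)
  show 2: "nbrs E v = {}" if "v \<notin> V"
    using simple that by (fastforce simp: nbrs_def)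
  show "finite (nbrs E v)"
    using 1 2 by (cases "v \<in> V") (auto intro: card_ge_0_finite)
  show "card (nbrs E v) \<le> k + 1"
    using 1 2 by (cases "v \<in> V") auto
qed

lemma is_T1_nbrs:
  assumes "is_T1 k V E v0"
  shows "v \<in> V \<Longrightarrow> v \<noteq> v0 \<Longrightarrow> card (nbrs E v) = k + 1" "card (nbrs E v0) = 1"
    "finite (nbrs E v)" "card (nbrs E v) \<le> k + 1"
proof -
  have simple: "\<And>e. e \<in> E \<Longrightarrow> card e = 2 \<and> e \<subseteq> V"
    using assms by (auto simp: is_T1_def infinite_tree_def simple_graph_def)
  then have deg: "degree E v = card (nbrs E v)" for v
    by (intro degree_eq_card_nbrs) auto
  show 1: "card (nbrs E v) = k + 1" if "v \<in> V" "v \<noteq> v0" for v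
    using assms deg[of v] that by (simp add: is_T1_def)
  show 0: "card (nbrs E v0) = 1"
    using assms deg[of v0] by (simp add: is_T1_def)
  have 2: "nbrs E v = {}" if "v \<notin> V"
    using simple that by (fastforce simp: nbrs_def)
  show "finite (nbrs E v)"
    using 0 1[of v] 2 by (cases "v \<in> V"; cases "v = v0") (auto intro: card_ge_0_finite)
  show "card (nbrs E v) \<le> k + 1"
    using 0 1[of v] 2 by (cases "v \<in> V"; cases "v = v0") auto
qed

lemma exp_log_vac_range: "k \<ge> 1 \<Longrightarrow> t \<in> {0..1} \<Longrightarrow> exp (log_vac k t) \<in> {0..1}"
  using log_vac_nonpos[of k t] by auto

lemma vacancy_regular_tree:
  assumes k: "k \<ge> 1" and T: "is_T k V E" and Vs: "exhausting V Vs" and \<tau>: "iid_uniform M E \<tau>" and t: "t \<in> {0..1}"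
  shows "v \<in> V \<Longrightarrow> measure M {\<omega> \<in> space M. rsa_rv E \<tau> Vs t v \<omega> = 0} = exp (log_vac k t) ^ (k + 1)"
    and "u \<in> V \<Longrightarrow> w \<in> V \<Longrightarrow> graph_dist E u w = Suc n \<Longrightarrow>
      covariance M (rsa_rv E \<tau> Vs t u) (rsa_rv E \<tau> Vs t w) =
      exp (log_vac k t) ^ (2 * k) * (pair_vac k n t - exp (log_vac k t) ^ 2)"
proof -
  have tree: "simple_graph V E" "connected_graph V E" "acyclic_graph E"
    using T by (auto simp: is_T_def infinite_tree_def)
  interpret iid_times M E \<tau>
    by (rule iid_times.intro) (rule \<tau>)
  interpret vol: rsa_volumes M E \<tau> V Vs "k + 1"
    using is_T_nbrs[OF T] tree Vs by unfold_locales auto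
  interpret rsa_limit_regular M E \<tau> vol.F k "\<lambda>t. exp (log_vac k t)" "pair_vac k"
  proof unfold_locales
    show "card (nbrs E y) = k + 1" if "{x, y} \<in> E" for x y
      using that tree(1) by (intro is_T_nbrs[OF T]) (auto simp: simple_graph_def)
  qed (use vol.card_edge tree vol.F_finite vol.F_subset vol.F_eventually vac_integral[OF k]
      pair_vac_0[OF k] pair_vac_integral[OF k] exp_log_vac_range[OF k] in auto)
  have one: "(\<lambda>j. vacant_prob (vol.F j) {v} t) \<longlonglongrightarrow> exp (log_vac k t) ^ (k + 1)" if "v \<in> V" for v
    using is_T_nbrs(1)[OF T that] regular_from t branches_cover[OF tree(1,2) that]
    by (intro vertex_tendsto) auto
  show "prob {\<omega> \<in> space M. rsa_rv E \<tau> Vs t v \<omega> = 0} = exp (log_vac k t) ^ (k + 1)" if "v \<in> V"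
    using t one[OF that] by (intro vol.prob_vacant) auto
  assume u: "u \<in> V" and w: "w \<in> V" and dist: "graph_dist E u w = Suc n"
  obtain y a where p: "dart_path E u y n a w"
    using graph_dist_dart_path[OF tree(2) u w dist] by blast
  have "(\<lambda>j. vacant_prob (vol.F j) {u, w} t) \<longlonglongrightarrow> exp (log_vac k t) ^ (2 * k) * pair_vac k n t"
    using branches_cover[OF tree(1,2)] u w by (intro pair_tendsto[OF p t]) auto
  then have "covariance M (rsa_rv E \<tau> Vs t u) (rsa_rv E \<tau> Vs t w) =
      exp (log_vac k t) ^ (2 * k) * pair_vac k n t - (exp (log_vac k t) ^ (k + 1))\<^sup>2"
    using t one[OF u] one[OF w] by (intro vol.covariance_eq) auto
  also have "(exp (log_vac k t) ^ (k + 1))\<^sup>2 = exp (log_vac k t) ^ (2 * k) * exp (log_vac k t) ^ 2"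
    by (simp only: power_mult[symmetric] power_add[symmetric]) (simp add: algebra_simps)
  finally show "covariance M (rsa_rv E \<tau> Vs t u) (rsa_rv E \<tau> Vs t w) =
      exp (log_vac k t) ^ (2 * k) * (pair_vac k n t - exp (log_vac k t) ^ 2)"
    by (simp only: right_diff_distrib)
qed

lemma vacancy_planted_tree:
  assumes k: "k \<ge> 1" and T: "is_T1 k V E v0" and Vs: "exhausting V Vs" and \<tau>: "iid_uniform M E \<tau>" and t: "t \<in> {0..1}"
  shows "measure M {\<omega> \<in> space M. rsa_rv E \<tau> Vs t v0 \<omega> = 0} = exp (log_vac k t)"
proof -
  have tree: "simple_graph V E" "connected_graph V E" "acyclic_graph E" and v0: "v0 \<in> V"
    using T by (auto simp: is_T1_def infinite_tree_def)
  interpret iid_times M E \<tau>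
    by (rule iid_times.intro) (rule \<tau>)
  interpret vol: rsa_volumes M E \<tau> V Vs "k + 1"
    using is_T1_nbrs[OF T] tree Vs by unfold_locales auto
  interpret rsa_limit M E \<tau> vol.F k "\<lambda>t. exp (log_vac k t)"
    by unfold_locales (use vol.card_edge tree vol.F_finite vol.F_subset vol.F_eventually vac_integral[OF k]
      exp_log_vac_range[OF k] in auto)
  \<comment> \<open>A non-backtracking walk does not return to \<open>v0\<close>, hence meets only vertices of degree \<open>k + 1\<close>.\<close>
  have "regular_from v0 y" for y
    unfolding regular_from_def
  proof (intro allI impI)
    fix m a c assume p: "dart_path E v0 y m a c"
    then have "c \<in> V"
      using tree(1) dart_path_edge[OF p] by (auto simp: simple_graph_def)
    then show "card (nbrs E c) = k + 1"
      using dart_path_neq[OF p] by (intro is_T1_nbrs[OF T]) auto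
  qed
  then have "(\<lambda>j. vacant_prob (vol.F j) {v0} t) \<longlonglongrightarrow> exp (log_vac k t) ^ 1"
    using is_T1_nbrs(2)[OF T] t branches_cover[OF tree(1,2) v0]
    by (intro vertex_tendsto) auto
  then show ?thesis
    using t by (intro vol.prob_vacant) auto
qed

theorem mainTheorem12:
  fixes k :: nat
    and V :: "'a set" and E :: "'a set set" and v :: 'a and Vs :: "nat \<Rightarrow> 'a set"
    and M :: "'w measure" and \<tau> :: "'a set \<Rightarrow> 'w \<Rightarrow> real"
    and V1 :: "'b set" and E1 :: "'b set set" and v0 :: 'b and Vs1 :: "nat \<Rightarrow> 'b set"
    and M1 :: "'w1 measure" and \<tau>1 :: "'b set \<Rightarrow> 'w1 \<Rightarrow> real"
    and \<alpha> \<beta> :: "real \<Rightarrow> real"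
  assumes "k \<ge> 1"
    and "is_T k V E" and "exhausting V Vs" and "iid_uniform M E \<tau>" and "v \<in> V"
    and "is_T1 k V1 E1 v0" and "exhausting V1 Vs1" and "iid_uniform M1 E1 \<tau>1"
    and "\<And>t. \<alpha> t = measure M {\<omega> \<in> space M. rsa_rv E \<tau> Vs t v \<omega> = 0}"
    and "\<And>t. \<beta> t = measure M1 {\<omega> \<in> space M1. rsa_rv E1 \<tau>1 Vs1 t v0 \<omega> = 0}"
  shows "(k \<ge> 2 \<longrightarrow> (\<forall>t\<in>{0..1}.
            \<beta> t = (1 + (real k - 1) * t) powr (- 1 / (real k - 1)) \<and>
            \<alpha> t = (1 + (real k - 1) * t) powr (- (real k + 1) / (real k - 1)) \<and>
            (\<forall>m\<ge>1. \<forall>u\<in>V. \<forall>w\<in>V. graph_dist E u w = m \<longrightarrow>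
               covariance M (rsa_rv E \<tau> Vs t u) (rsa_rv E \<tau> Vs t w) =
               \<beta> t ^ (2 * k) *
               (real k * (2 * ln (\<beta> t)) ^ (m - 1) / (fact (m - 1) * (real k - 1))
                - (\<Sum>i. let j = i + (m - 1) in
                     (2 * ln (\<beta> t)) ^ j / fact j
                     - 1 / 2 * (2 / (1 - real k)) ^ m * (((1 - real k) * ln (\<beta> t)) ^ j / fact j))))))
       \<and> (k = 1 \<longrightarrow> (\<forall>t\<in>{0..1}.
            \<beta> t = exp (- t) \<and>
            \<alpha> t = exp (- 2 * t) \<and>
            (\<forall>m\<ge>1. \<forall>u\<in>V. \<forall>w\<in>V. graph_dist E u w = m \<longrightarrow>
               covariance M (rsa_rv E \<tau> Vs t u) (rsa_rv E \<tau> Vs t w) =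
               - exp (- 2 * t) *
               (1 / 2 * ((- 2 * t) ^ m / fact m)
                + (\<Sum>i. let n = i + (m + 1) in (- 2 * t) ^ n / fact n)))))"
proof -
  note tree = vacancy_regular_tree[OF assms(1-4)]
  have \<beta>: "\<beta> t = exp (log_vac k t)" if "t \<in> {0..1}" for t
    using vacancy_planted_tree[OF assms(1,6-8) that] assms(10) by simp
  have \<alpha>: "\<alpha> t = exp (log_vac k t) ^ (k + 1)" if "t \<in> {0..1}" for t
    using tree(1)[OF that assms(5)] assms(9) by simp
  have sq: "exp (log_vac k t) ^ 2 = exp (2 * log_vac k t)" for t
    by (simp add: exp_double)
  show ?thesis
  proof (intro conjI impI ballI allI)
    fix t :: real assume k: "k \<ge> 2" and t: "t \<in> {0..1}"
    have c: "real k - 1 > 0" using k by simp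
    then have pos: "1 + (real k - 1) * t > 0"
      using t by (intro add_pos_nonneg) auto
    have L: "log_vac k t = - ln (1 + (real k - 1) * t) / (real k - 1)"
      using k by (simp add: log_vac_def)
    show "\<beta> t = (1 + (real k - 1) * t) powr (- 1 / (real k - 1))"
      unfolding \<beta>[OF t] L using pos by (simp add: powr_def)
    show "\<alpha> t = (1 + (real k - 1) * t) powr (- (real k + 1) / (real k - 1))"
      proof -
      have "real (k + 1) * (- l / (real k - 1)) = - (real k + 1) / (real k - 1) * l" for l
        by (simp add: divide_inverse algebra_simps)
      then show ?thesis
        unfolding \<alpha>[OF t] exp_of_nat_mult[symmetric] L using pos by (simp only: powr_def) simp
    qed
    fix m u w assume m: "1 \<le> m" and uw: "u \<in> V" "w \<in> V" "graph_dist E u w = m"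
    obtain n where n: "m = Suc n" using m by (cases m) auto
    let ?L = "log_vac k t" and ?d = "1 / 2 * (2 / (1 - real k)) ^ Suc n"
    have ln: "ln (\<beta> t) = ?L"
      using \<beta>[OF t] by simp
    have sum: "(\<Sum>i. (2 * ?L) ^ (i + n) / fact (i + n) - ?d * (((1 - real k) * ?L) ^ (i + n) / fact (i + n))) =
        (exp (2 * ?L) - exp_partial n (2 * ?L)) - ?d * (exp ((1 - real k) * ?L) - exp_partial n ((1 - real k) * ?L))"
      using summable_exp_tail[of "2 * ?L" n] summable_exp_tail[of "(1 - real k) * ?L" n]
      by (subst suminf_diff[symmetric]) (auto intro: summable_mult simp only: suminf_mult exp_tail)
    have "covariance M (rsa_rv E \<tau> Vs t u) (rsa_rv E \<tau> Vs t w) =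
        exp ?L ^ (2 * k) * (pair_poly k n ?L - exp (2 * ?L))"
      using tree(2)[OF t uw(1,2), of n] uw(3) n k unfolding sq by (simp add: pair_vac_def)
    then show "covariance M (rsa_rv E \<tau> Vs t u) (rsa_rv E \<tau> Vs t w) =
       \<beta> t ^ (2 * k) *
       (real k * (2 * ln (\<beta> t)) ^ (m - 1) / (fact (m - 1) * (real k - 1))
        - (\<Sum>i. let j = i + (m - 1) in
             (2 * ln (\<beta> t)) ^ j / fact j
             - 1 / 2 * (2 / (1 - real k)) ^ m * (((1 - real k) * ln (\<beta> t)) ^ j / fact j)))"
      unfolding ln unfolding \<beta>[OF t] n diff_Suc_1 Let_def sum pair_poly_def
      by (simp add: algebra_simps)
  next
    fix t :: real assume k: "k = 1" and t: "t \<in> {0..1}"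
    have L: "log_vac k t = - t"
      using k by (simp add: log_vac_def)
    show "\<beta> t = exp (- t)"
      using \<beta>[OF t] L by simp
    show "\<alpha> t = exp (- 2 * t)"
      using \<alpha>[OF t] k unfolding L by (simp add: exp_double[symmetric] flip: power2_eq_square)
    fix m u w assume m: "1 \<le> m" and uw: "u \<in> V" "w \<in> V" "graph_dist E u w = m"
    obtain n where n: "m = Suc n" using m by (cases m) auto
    let ?x = "- 2 * t"
    have sum: "(\<Sum>i. ?x ^ (i + (m + 1)) / fact (i + (m + 1))) = exp ?x - (exp_partial m ?x + ?x ^ m / fact m)"
      unfolding exp_tail by (simp add: exp_partial_def)
    have "covariance M (rsa_rv E \<tau> Vs t u) (rsa_rv E \<tau> Vs t w) =
        exp (- t) ^ 2 * (exp_partial m ?x + 1 / 2 * (?x ^ m / fact m) - exp (- t) ^ 2)"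
      using tree(2)[OF t uw(1,2), of n] uw(3) n k unfolding L by (simp add: pair_vac_def)
    also have "exp (- t) ^ 2 = exp ?x"
      by (simp add: exp_double[symmetric])
    finally have cov: "covariance M (rsa_rv E \<tau> Vs t u) (rsa_rv E \<tau> Vs t w) =
        exp ?x * (exp_partial m ?x + 1 / 2 * (?x ^ m / fact m) - exp ?x)" .
    show "covariance M (rsa_rv E \<tau> Vs t u) (rsa_rv E \<tau> Vs t w) =
       - exp (- 2 * t) *
       (1 / 2 * ((- 2 * t) ^ m / fact m)
        + (\<Sum>i. let n = i + (m + 1) in (- 2 * t) ^ n / fact n))"
      unfolding Let_def sum cov by (simp only: algebra_simps)
  qed
qed

end
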